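(* Let $(\boldsymbol\mu_n)_{n\ge1}$ be a sequence of independent random measures in $\mathcal{P}(\mathbb{R})$, identically distributed with law $P_\mu$, and suppose that $\int_{\mathcal{P}(\mathbb{R})}J(\mu,\nu)\,dP_\mu(\mu)<+\infty$ for some $\nu\in\mathcal{P}(\mathbb{R})$. Then the empirical Fréchet barycenters $\boldsymbol\nu_n=\operatorname{bar}(\boldsymbol\mu_i,1/n)_{1\le i\le n}$ converge weakly to $\nu^*:=\operatorname{bar}(P_\mu)$ almost surely.
   Context: $g\colon\mathbb{R}\to\mathbb{R}$ is a strictly convex function that attains its minimum at $0$, with $g(0)=0$. $\mathcal{P}(\mathbb{R})$ is the set of Borel probability measures on $\mathbb{R}$ with the topology of weak convergence and its Borel $\sigma$-algebra; $P_\mu$ is a probability measure on this $\sigma$-algebra. For $\mu\in\mathcal{P}(\mathbb{R})$, $F_\mu(x)=\mu((-\infty,x))$ and the quantile function is $F_\mu^{-1}(y)=\inf\{x\colon F_\mu(x)\ge y\}$ for $0<y<1$. The transportation cost is $$J(\mu,\nu) := \inf_{\gamma\in\Pi(\mu,\nu)}\int_{\mathbb{R}\times\mathbb{R}} g(x-y)\,d\gamma(x,y) = \int_0^1 g\bigl(F_\mu^{-1}(x)-F_\nu^{-1}(x)\bigr)\,dx\in[0,+\infty],$$ where $\Pi(\mu,\nu)$ is the set of probability measures on $\mathbb{R}^2$ with first marginal $\mu$ and second marginal $\nu$. For $\mu_1,\dots,\mu_n\in\mathcal{P}(\mathbb{R})$ and weights $\lambda_i>0$, the Fréchet barycenter $\operatorname{bar}(\mu_i,\lambda_i)_{1\le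 i\le n}$ is the minimizer of $\nu\mapsto\sum_{i=1}^n\lambda_iJ(\mu_i,\nu)$ over $\mathcal{P}(\mathbb{R})$; it exists and is unique whenever this functional is finite for some $\nu$ (here this is the case almost surely). $\operatorname{bar}(P_\mu)$ is the minimizer of $\nu\mapsto\int J(\mu,\nu)\,dP_\mu(\mu)$ over $\mathcal{P}(\mathbb{R})$; it exists and is unique whenever this functional is finite for some $\nu$. *)

theory Defs
  imports "HOL-Probability.Probability"
begin

definition strictly_convex :: "(real \<Rightarrow> real) \<Rightarrow> bool" where
  "strictly_convex g \<longleftrightarrow>
    (\<forall>x y u. x \<noteq> y \<longrightarrow> 0 < u \<longrightarrow> u < 1 \<longrightarrow>
      g (u * x + (1 - u) * y) < u * g x + (1 - u) * g y)"

text \<open>The elements of \<open>\<P>(\<real>)\<close> are the measures satisfying \<^const>\<open>real_distribution\<close>. Their weak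
  topology is the coarsest one making \<open>\<mu> \<mapsto> \<integral> f d\<mu>\<close> continuous for every bounded continuous \<open>f\<close>.\<close>

definition weak_topology :: "real measure topology" where
  "weak_topology = topology_generated_by
     {{\<mu>. real_distribution \<mu> \<and> integral\<^sup>L \<mu> f \<in> U} | (f :: real \<Rightarrow> real) U.
        continuous_on UNIV f \<and> bounded (range f) \<and> open U}"

definition weak_borel :: "real measure measure" where
  "weak_borel = sigma (topspace weak_topology) {A. openin weak_topology A}"

definition couplings :: "real measure \<Rightarrow> real measure \<Rightarrow> (real \<times> real) measure set" where
  "couplings \<mu> \<nu> = {\<gamma>. prob_space \<gamma> \<and> sets \<gamma> = sets borel \<and>
     distr \<gamma> borel fst = \<mu> \<and> distr \<gamma> borel snd = \<nu>}"

text \<open>The coercion \<^const>\<open>ennreal\<close> truncates negative values; the costs considered here are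
  nonnegative.\<close>

definition transport_cost :: "(real \<Rightarrow> real) \<Rightarrow> real measure \<Rightarrow> real measure \<Rightarrow> ennreal" where
  "transport_cost g \<mu> \<nu> = (INF \<gamma>\<in>couplings \<mu> \<nu>. \<integral>\<^sup>+ (x, y). ennreal (g (x - y)) \<partial>\<gamma>)"

definition frechet_barycenter ::
    "(real \<Rightarrow> real) \<Rightarrow> nat \<Rightarrow> (nat \<Rightarrow> real measure) \<Rightarrow> (nat \<Rightarrow> real) \<Rightarrow> real measure" where
  "frechet_barycenter g n \<mu> w =
     (THE \<nu>. is_arg_min (\<lambda>\<nu>. \<Sum>i=1..n. ennreal (w i) * transport_cost g (\<mu> i) \<nu>)
        real_distribution \<nu>)"

definition law_barycenter :: "(real \<Rightarrow> real) \<Rightarrow> real measure measure \<Rightarrow> real measure" where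
  "law_barycenter g P =
     (THE \<nu>. is_arg_min (\<lambda>\<nu>. \<integral>\<^sup>+ \<mu>. transport_cost g \<mu> \<nu> \<partial>P) real_distribution \<nu>)"

lemma topspace_weak_topology: "topspace weak_topology = {\<mu>. real_distribution \<mu>}"
proof -
  have "{\<mu>. real_distribution \<mu>} = {\<mu>. real_distribution \<mu> \<and> integral\<^sup>L \<mu> (\<lambda>x. 0::real) \<in> UNIV}"
    by simp
  moreover have "continuous_on UNIV (\<lambda>x::real. 0::real) \<and> bounded (range (\<lambda>x::real. 0::real)) \<and>
      open (UNIV :: real set)"
    by simp
  ultimately have "{\<mu>. real_distribution \<mu>} \<in>
     {{\<mu>. real_distribution \<mu> \<and> integral\<^sup>L \<mu> f \<in> U} | (f :: real \<Rightarrow> real) U.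
        continuous_on UNIV f \<and> bounded (range f) \<and> open U}"
    by blast
  then show ?thesis
    unfolding weak_topology_def topology_generated_by_topspace by blast
qed

lemma limitin_weak_topology_iff:
  "limitin weak_topology \<mu> \<nu> F \<longleftrightarrow>
     real_distribution \<nu> \<and> (\<forall>\<^sub>F i in F. real_distribution (\<mu> i)) \<and>
     (\<forall>f :: real \<Rightarrow> real. continuous_on UNIV f \<longrightarrow> bounded (range f) \<longrightarrow>
        ((\<lambda>i. integral\<^sup>L (\<mu> i) f) \<longlongrightarrow> integral\<^sup>L \<nu> f) F)" (is "?L \<longleftrightarrow> ?R")
proof
  assume L: ?L
  then have \<nu>: "\<nu> \<in> topspace weak_topology"
    and ev: "\<And>U. openin weak_topology U \<Longrightarrow> \<nu> \<in> U \<Longrightarrow> \<forall>\<^sub>F i in F. \<mu> i \<in> U"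
    unfolding limitin_def by simp_all
  have 1: "real_distribution \<nu>" "\<forall>\<^sub>F i in F. real_distribution (\<mu> i)"
    using \<nu> ev[OF openin_topspace \<nu>] by (simp_all add: topspace_weak_topology)
  have 2: "((\<lambda>i. integral\<^sup>L (\<mu> i) f) \<longlongrightarrow> integral\<^sup>L \<nu> f) F"
    if f: "continuous_on UNIV f" "bounded (range f)" for f :: "real \<Rightarrow> real"
  proof (rule topological_tendstoI)
    fix U :: "real set" assume U: "open U" "integral\<^sup>L \<nu> f \<in> U"
    let ?S = "{\<mu>. real_distribution \<mu> \<and> integral\<^sup>L \<mu> f \<in> U}"
    have "openin weak_topology ?S"
      unfolding weak_topology_def by (rule topology_generated_by_Basis) (use f U in blast)
    moreover have "\<nu> \<in> ?S"
      using 1 U by simp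
    ultimately have "\<forall>\<^sub>F i in F. \<mu> i \<in> ?S"
      by (rule ev)
    then show "\<forall>\<^sub>F i in F. integral\<^sup>L (\<mu> i) f \<in> U"
      by eventually_elim simp
  qed
  show ?R using 1 by (intro conjI allI impI 2) auto
next
  assume R: ?R
  have "\<nu> \<in> W \<longrightarrow> (\<forall>\<^sub>F i in F. \<mu> i \<in> W)" if "openin weak_topology W" for W
    using openin_topology_generated_by[OF that[unfolded weak_topology_def]]
  proof induction
    case Empty
    then show ?case by simp
  next
    case (Int a b)
    then show ?case by (simp add: eventually_conj_iff)
  next
    case (UN K)
    show ?case
    proof
      assume "\<nu> \<in> \<Union>K"
      then obtain k where k: "k \<in> K" "\<nu> \<in> k" by blast
      with UN have "\<forall>\<^sub>F i in F. \<mu> i \<in> k" by blast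
      then show "\<forall>\<^sub>F i in F. \<mu> i \<in> \<Union>K"
        by (rule eventually_mono) (use k in blast)
    qed
  next
    case (Basis s)
    then obtain f :: "real \<Rightarrow> real" and U where s: "s = {\<mu>. real_distribution \<mu> \<and> integral\<^sup>L \<mu> f \<in> U}"
      and f: "continuous_on UNIV f" "bounded (range f)" and U: "open U" by blast
    show ?case
    proof
      assume "\<nu> \<in> s"
      then have "\<forall>\<^sub>F i in F. integral\<^sup>L (\<mu> i) f \<in> U"
        using R f U s by (intro topological_tendstoD[where S = U]) simp_all
      moreover have "\<forall>\<^sub>F i in F. real_distribution (\<mu> i)"
        using R by blast
      ultimately show "\<forall>\<^sub>F i in F. \<mu> i \<in> s"
        unfolding s by eventually_elim simp
    qed
  qed
  then show ?L
    using R unfolding limitin_def topspace_weak_topology by simp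
qed

lemma limitin_weak_topology_iff_weak_conv_m:
  assumes \<mu>: "\<And>n. real_distribution (\<mu> n)" and \<nu>: "real_distribution \<nu>"
  shows "limitin weak_topology \<mu> \<nu> sequentially \<longleftrightarrow> weak_conv_m \<mu> \<nu>"
proof
  assume "limitin weak_topology \<mu> \<nu> sequentially"
  then have *: "(\<lambda>n. integral\<^sup>L (\<mu> n) f) \<longlonglongrightarrow> integral\<^sup>L \<nu> f"
    if "continuous_on UNIV f" "bounded (range f)" for f :: "real \<Rightarrow> real"
    using that unfolding limitin_weak_topology_iff by blast
  show "weak_conv_m \<mu> \<nu>"
  proof (rule integral_bdd_continuous_conv_imp_weak_conv[OF \<mu> \<nu>])
    fix f :: "real \<Rightarrow> real" assume "\<And>x. isCont f x" "\<And>x. \<bar>f x\<bar> \<le> 1"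
    then show "(\<lambda>n. integral\<^sup>L (\<mu> n) f) \<longlonglongrightarrow> integral\<^sup>L \<nu> f"
      by (intro *) (auto intro: continuous_at_imp_continuous_on simp: bounded_iff)
  qed
next
  assume w: "weak_conv_m \<mu> \<nu>"
  have "(\<lambda>n. integral\<^sup>L (\<mu> n) f) \<longlonglongrightarrow> integral\<^sup>L \<nu> f"
    if f: "continuous_on UNIV f" "bounded (range f)" for f :: "real \<Rightarrow> real"
  proof -
    obtain B where "\<And>x. norm (f x) \<le> B"
      using f(2) by (auto simp: bounded_iff)
    moreover have "isCont f x" for x
      using f(1) by (simp add: continuous_on_eq_continuous_at)
    ultimately show ?thesis
      by (intro weak_conv_imp_integral_bdd_continuous_conv[OF \<mu> \<nu> w])
  qed
  then show "limitin weak_topology \<mu> \<nu> sequentially"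
    unfolding limitin_weak_topology_iff using \<mu> \<nu> by simp
qed

end

theory Submission
  imports Defs
begin

text \<open>
On the line, a convex cost \<open>g (x - y)\<close> is transported optimally by matching quantiles, so the transport
cost of \<open>\<mu>\<close> and \<open>\<nu>\<close> is the integral of \<open>g (q \<mu> u - q \<nu> u)\<close> over \<open>0 < u < 1\<close>, with \<open>q\<close> denoting
quantile functions (\<open>transport_cost_eq\<close>). By Tonelli's theorem the barycenter problem for a law \<open>P\<close> on
measures separates into one problem for each level \<open>u\<close>: minimise the level cost
\<open>h u y = \<integral> g (q \<mu> u - y) \<partial>P \<mu>\<close> over real \<open>y\<close>. As \<open>g\<close> is strictly convex with its minimum at \<open>0\<close>, the
level cost has exactly one minimiser wherever it is finite somewhere, and this minimiser is
nondecreasing in \<open>u\<close>. The barycenter is the measure whose quantile function consists of these minimisers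
(\<open>law_barycenter_level_minimizer\<close>). An empirical barycenter is the barycenter of the empirical law of
the sample, so it has the same description, with averages over the sample in place of \<open>h\<close>.

Fix a level \<open>u\<close> and let \<open>y\<close> be the minimiser of \<open>h u\<close>. For \<open>z \<noteq> y\<close> the law of large numbers makes the
empirical level cost at \<open>z\<close> eventually larger than that at \<open>y\<close>. By convexity the empirical minimiser is
then eventually caught between any two such points \<open>z\<close> on either side of \<open>y\<close>, so it converges to \<open>y\<close>.
The value \<open>h u z\<close> may be infinite, and only the comparison of two sums is needed; this is
\<open>sums_eventually_less\<close>, which rests on the maximal ergodic inequality and Kolmogorov's zero-one law.
Taking countably many levels that are dense in the unit interval gives almost sure convergence of the
quantiles on a dense set, and this implies weak convergence because quantile functions are monotone
(\<open>weak_conv_m_of_quantiles\<close>).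
\<close>

section \<open>Eventual comparison of i.i.d. sums\<close>

text \<open>\<open>max_partial_sum n w\<close> is the maximum of \<open>0, w 0, w 0 + w 1, \<dots>\<close> over the partial sums with at most
\<open>n\<close> terms. The recursion peels off the first term and shifts the sequence, which is the form in
which shift invariance of the law of an i.i.d. sequence can be applied.\<close>
fun max_partial_sum :: "nat \<Rightarrow> (nat \<Rightarrow> real) \<Rightarrow> real" where
  "max_partial_sum 0 w = 0"
| "max_partial_sum (Suc n) w = max 0 (w 0 + max_partial_sum n (\<lambda>i. w (Suc i)))"

lemma max_partial_sum_nonneg: "0 \<le> max_partial_sum n w"
  by (cases n) auto

lemma partial_sum_le_max: "k \<le> n \<Longrightarrow> (\<Sum>i<k. w i) \<le> max_partial_sum n w"
proof (induction n arbitrary: k w)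
  case (Suc n)
  show ?case
  proof (cases k)
    case (Suc l)
    have "(\<Sum>i<l. w (Suc i)) \<le> max_partial_sum n (\<lambda>i. w (Suc i))"
      using Suc Suc.prems Suc.IH[of l "\<lambda>i. w (Suc i)"] by simp
    then show ?thesis
      using Suc by (simp add: sum.lessThan_Suc_shift del: sum.lessThan_Suc)
  qed simp
qed simp

lemma max_partial_sum_mono: "max_partial_sum n w \<le> max_partial_sum (Suc n) w"
proof (induction n arbitrary: w)
  case (Suc n)
  from Suc[of "\<lambda>i. w (Suc i)"] show ?case by (simp add: max_def)
qed simp

lemma max_partial_sum_measurable [measurable]:
  "max_partial_sum n \<in> borel_measurable (\<Pi>\<^sub>M i\<in>UNIV. borel)"
proof (induction n)
  case (Suc n)
  have shift: "(\<lambda>w. (\<lambda>i. w (Suc i))) \<in> (\<Pi>\<^sub>M i\<in>UNIV. borel) \<rightarrow>\<^sub>M (\<Pi>\<^sub>M i\<in>UNIV. (borel :: real measure))"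
    by (rule measurable_PiM_single') (auto simp: space_PiM)
  have [measurable]: "(\<lambda>w. max_partial_sum n (\<lambda>i. w (Suc i))) \<in> borel_measurable (\<Pi>\<^sub>M i\<in>UNIV. borel)"
    by (rule measurable_compose[OF shift Suc])
  have "max_partial_sum (Suc n) = (\<lambda>w. max 0 (w 0 + max_partial_sum n (\<lambda>i. w (Suc i))))"
    by (rule ext) simp
  also have "\<dots> \<in> borel_measurable (\<Pi>\<^sub>M i\<in>UNIV. borel)"
    by measurable
  finally show ?case .
qed simp

lemma (in prob_space) indep_vars_reindex:
  assumes indep: "indep_vars (\<lambda>_. N) X (f ` I)" and "inj_on f I"
  shows "indep_vars (\<lambda>_. N) (\<lambda>i. X (f i)) I"
  unfolding indep_vars_def
proof (intro conjI ballI indep_setsI)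
  let ?S = "\<lambda>i. sigma_sets (space M) {X i -` A \<inter> space M |A. A \<in> sets N}"
  fix A J
  assume J: "J \<noteq> {}" "J \<subseteq> I" "finite J" "\<forall>j\<in>J. A j \<in> ?S (f j)"
  then have inj: "inj_on f J"
    using \<open>inj_on f I\<close> inj_on_subset by blast
  have "prob (\<Inter>j\<in>f ` J. A (the_inv_into J f j)) = (\<Prod>j\<in>f ` J. prob (A (the_inv_into J f j)))"
    by (rule indep_setsD[of ?S "f ` I"])
       (use J indep inj in \<open>auto simp: indep_vars_def the_inv_into_f_f\<close>)
  then show "prob (\<Inter>j\<in>J. A j) = (\<Prod>j\<in>J. prob (A j))"
    using inj by (simp add: prod.reindex the_inv_into_f_f)
qed (use indep in \<open>auto simp: indep_vars_def indep_sets_def\<close>)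

locale iid_sequence = prob_space M for M :: "'w measure" +
  fixes Z :: "nat \<Rightarrow> 'w \<Rightarrow> real"
  assumes indep: "indep_vars (\<lambda>_. borel) Z UNIV"
    and identical: "\<And>i. distr M borel (Z i) = distr M borel (Z 0)"
begin

lemma rv [measurable]: "Z i \<in> borel_measurable M"
  using indep by (auto simp: indep_vars_def)

lemma compose:
  assumes [measurable]: "f \<in> borel_measurable borel"
  shows "iid_sequence M (\<lambda>i \<omega>. f (Z i \<omega>))"
proof
  show "indep_vars (\<lambda>_. borel) (\<lambda>i \<omega>. f (Z i \<omega>)) UNIV"
    by (rule indep_vars_compose2[OF indep]) auto
  have "distr M borel (\<lambda>\<omega>. f (Z i \<omega>)) = distr (distr M borel (Z i)) borel f" for i
    by (simp add: distr_distr comp_def)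
  then show "distr M borel (\<lambda>\<omega>. f (Z i \<omega>)) = distr M borel (\<lambda>\<omega>. f (Z 0 \<omega>))" for i
    using identical[of i] by simp
qed

text \<open>Both sides are the countable product of the common law of the \<open>Z i\<close>.\<close>
lemma shift_invariant:
  "distr M (\<Pi>\<^sub>M i\<in>UNIV. borel) (\<lambda>\<omega> i. Z (Suc i) \<omega>) = distr M (\<Pi>\<^sub>M i\<in>UNIV. borel) (\<lambda>\<omega> i. Z i \<omega>)"
proof -
  have "indep_vars (\<lambda>_. borel) (\<lambda>i. Z (Suc i)) UNIV"
    by (rule indep_vars_reindex[where f = Suc]) (auto intro: indep_vars_subset[OF indep])
  moreover have "(\<lambda>i. distr M borel (Z (Suc i))) = (\<lambda>i. distr M borel (Z i))"
    using identical by metis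
  ultimately show ?thesis
    using indep indep_vars_iff_distr_eq_PiM[where I = UNIV and M' = "\<lambda>_. borel" and X = Z]
      indep_vars_iff_distr_eq_PiM[where I = UNIV and M' = "\<lambda>_. borel" and X = "\<lambda>i. Z (Suc i)"]
    by (simp add: restrict_def)
qed

lemma integrable_Z:
  assumes "integrable M (Z 0)"
  shows "integrable M (Z i)"
proof -
  have "integrable (distr M borel (Z i)) (\<lambda>x. x)"
    unfolding identical[of i] using assms by (simp add: integrable_distr_eq)
  then show ?thesis by (simp add: integrable_distr_eq)
qed

lemma integrable_max_partial_sum:
  assumes "integrable M (Z 0)"
  shows "integrable M (\<lambda>\<omega>. max_partial_sum n (\<lambda>i. Z (i + k) \<omega>))"
proof (induction n arbitrary: k)
  case (Suc n)
  from Suc[of "Suc k"] integrable_Z[OF assms, of k] show ?case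
    by (auto intro!: integrable_max)
qed simp

text \<open>The maximal ergodic inequality. Let \<open>m (n + 1)\<close> be the maximal partial sum of \<open>Z\<close> and \<open>m' n\<close> that of
the shifted sequence. Where \<open>m (n + 1)\<close> is positive, it equals \<open>Z 0 + m' n\<close>; elsewhere it is zero.
Hence \<open>Z 0\<close> integrated over \<open>{m (n + 1) > 0}\<close> is at least \<open>E (m (n + 1)) - E (m' n)\<close>, and this is
nonnegative because \<open>m' n\<close> has the law of \<open>m n \<le> m (n + 1)\<close>. If some partial sum is almost surely
positive, these events exhaust the space.\<close>
theorem expectation_nonneg_of_recurrent:
  assumes int: "integrable M (Z 0)"
    and pos: "AE \<omega> in M. \<exists>n. 0 < (\<Sum>i<n. Z i \<omega>)"
  shows "0 \<le> expectation (Z 0)"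
proof -
  define m where "m n \<omega> = max_partial_sum n (\<lambda>i. Z i \<omega>)" for n \<omega>
  define m' where "m' n \<omega> = max_partial_sum n (\<lambda>i. Z (Suc i) \<omega>)" for n \<omega>
  have [measurable, simp]: "m n \<in> borel_measurable M" "integrable M (m n)" "integrable M (m' n)" for n
    using integrable_max_partial_sum[OF int, of n 0] integrable_max_partial_sum[OF int, of n 1]
    by (auto simp: m_def[abs_def] m'_def[abs_def])
  have seqmeas [measurable]: "(\<lambda>\<omega> i. Z (i + k) \<omega>) \<in> M \<rightarrow>\<^sub>M (\<Pi>\<^sub>M i\<in>UNIV. borel)" for k
    by (rule measurable_PiM_single') auto
  have "expectation (m n) = expectation (m' n)" for n
  proof -
    have "expectation (m' n) =
        integral\<^sup>L (distr M (\<Pi>\<^sub>M i\<in>UNIV. borel) (\<lambda>\<omega> i. Z (Suc i) \<omega>)) (max_partial_sum n)"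
      using seqmeas[of 1] by (subst integral_distr) (auto simp: m'_def[abs_def])
    also have "\<dots> = expectation (m n)"
      unfolding shift_invariant using seqmeas[of 0]
      by (subst integral_distr) (auto simp: m_def[abs_def])
    finally show ?thesis by simp
  qed
  note same = this
  have "0 \<le> expectation (m (Suc n)) - expectation (m' n)" for n
    unfolding same[symmetric]
    unfolding diff_ge_0_iff_ge
    by (intro integral_mono) (use max_partial_sum_mono in \<open>auto simp: m_def simp del: max_partial_sum.simps\<close>)
  moreover have "expectation (m (Suc n)) - expectation (m' n)
      \<le> expectation (\<lambda>\<omega>. Z 0 \<omega> * indicator {\<omega>. 0 < m (Suc n) \<omega>} \<omega>)" for n
  proof -
    have "expectation (m (Suc n)) - expectation (m' n) = expectation (\<lambda>\<omega>. m (Suc n) \<omega> - m' n \<omega>)"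
      by (rule Bochner_Integration.integral_diff[symmetric]) auto
    also have "\<dots> \<le> expectation (\<lambda>\<omega>. Z 0 \<omega> * indicator {\<omega>. 0 < m (Suc n) \<omega>} \<omega>)"
    proof (rule integral_mono)
      show "integrable M (\<lambda>\<omega>. Z 0 \<omega> * indicator {\<omega>. 0 < m (Suc n) \<omega>} \<omega>)"
        by (rule Bochner_Integration.integrable_bound[OF int]) (auto split: split_indicator)
      show "m (Suc n) \<omega> - m' n \<omega> \<le> Z 0 \<omega> * indicator {\<omega>. 0 < m (Suc n) \<omega>} \<omega>" for \<omega>
        using max_partial_sum_nonneg[of n "\<lambda>i. Z (Suc i) \<omega>"]
        by (auto simp: m_def m'_def split: split_indicator)
    qed auto
    finally show ?thesis .
  qed
  ultimately have nn: "0 \<le> expectation (\<lambda>\<omega>. Z 0 \<omega> * indicator {\<omega>. 0 < m (Suc n) \<omega>} \<omega>)" for n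
    by (rule order_trans)
  have "(\<lambda>n. expectation (\<lambda>\<omega>. Z 0 \<omega> * indicator {\<omega>. 0 < m (Suc n) \<omega>} \<omega>)) \<longlonglongrightarrow> expectation (Z 0)"
  proof (rule integral_dominated_convergence)
    show "AE \<omega> in M. (\<lambda>n. Z 0 \<omega> * indicator {\<omega>. 0 < m (Suc n) \<omega>} \<omega>) \<longlonglongrightarrow> Z 0 \<omega>"
      using pos
    proof eventually_elim
      fix \<omega> assume "\<exists>n. 0 < (\<Sum>i<n. Z i \<omega>)"
      then obtain k where k: "0 < (\<Sum>i<k. Z i \<omega>)" ..
      have "\<forall>\<^sub>F n in sequentially. Z 0 \<omega> * indicator {\<omega>. 0 < m (Suc n) \<omega>} \<omega> = Z 0 \<omega>"
        using eventually_ge_at_top[of k]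
      proof eventually_elim
        case (elim n)
        then have "0 < m (Suc n) \<omega>"
          using k partial_sum_le_max[of k "Suc n" "\<lambda>i. Z i \<omega>"] by (simp add: m_def)
        then show ?case by simp
      qed
      then show "(\<lambda>n. Z 0 \<omega> * indicator {\<omega>. 0 < m (Suc n) \<omega>} \<omega>) \<longlonglongrightarrow> Z 0 \<omega>"
        by (rule tendsto_eventually)
    qed
    show "AE \<omega> in M. norm (Z 0 \<omega> * indicator {\<omega>. 0 < m (Suc n) \<omega>} \<omega>) \<le> \<bar>Z 0 \<omega>\<bar>" for n
      by (auto split: split_indicator)
  qed (use int in auto)
  then show ?thesis
    by (rule LIMSEQ_le_const) (use nn in auto)
qed

text \<open>This is the condition that the limit superior of the averages is negative. Written with a countable
family of rates it is visibly measurable, and it does not change when finitely many terms of the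
sequence do.\<close>
definition drifts_down :: "(nat \<Rightarrow> real) \<Rightarrow> bool" where
  "drifts_down w \<longleftrightarrow> (\<exists>k. \<forall>\<^sub>F n in sequentially. (\<Sum>i<n. w i) < - (real n / real (Suc k)))"

lemma drifts_down_cong_tail:
  assumes eq: "\<And>i. m \<le> i \<Longrightarrow> w i = v i" and w: "drifts_down w"
  shows "drifts_down v"
proof -
  from w obtain k where k: "\<forall>\<^sub>F n in sequentially. (\<Sum>i<n. w i) < - (real n / real (Suc k))"
    by (auto simp: drifts_down_def)
  define C where "C = (\<Sum>i<m. v i) - (\<Sum>i<m. w i)"
  define d where "d = 1 / real (Suc k) - 1 / real (Suc (Suc k))"
  \<comment> \<open>Passing from rate \<open>1 / (k + 1)\<close> to \<open>1 / (k + 2)\<close> gains \<open>n d\<close>, which absorbs the constant \<open>C\<close>.\<close>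
  have "1 / real (Suc (Suc k)) < 1 / real (Suc k)"
    by (intro divide_strict_left_mono) auto
  then have "0 < d" by (simp add: d_def)
  obtain N :: nat where "C / d < real N"
    using reals_Archimedean2 by blast
  then have "\<forall>\<^sub>F n in sequentially. C < real n * d"
  proof (intro eventually_sequentiallyI[of N])
    fix n assume "N \<le> n"
    then have "C / d < real n"
      using \<open>C / d < real N\<close> by linarith
    then show "C < real n * d"
      using \<open>0 < d\<close> by (simp add: pos_divide_less_eq)
  qed
  with k have "\<forall>\<^sub>F n in sequentially. (\<Sum>i<n. v i) < - (real n / real (Suc (Suc k)))"
    using eventually_ge_at_top[of m]
  proof eventually_elim
    case (elim n)
    have split: "(\<Sum>i<n. f i) = (\<Sum>i<m. f i) + (\<Sum>i=m..<n. f i)" for f :: "nat \<Rightarrow> real"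
      using elim by (metis le0 lessThan_atLeast0 sum.atLeastLessThan_concat)
    have "(\<Sum>i=m..<n. v i) = (\<Sum>i=m..<n. w i)"
      by (rule sum.cong) (auto simp: eq)
    then have "(\<Sum>i<n. v i) = (\<Sum>i<n. w i) + C"
      unfolding C_def split[of v] split[of w] by simp
    with elim show ?case by (simp add: d_def right_diff_distrib)
  qed
  then show ?thesis unfolding drifts_down_def by blast
qed

text \<open>Setting the first \<open>m\<close> variables to zero does not affect the event, so it lies in the tail
\<open>\<sigma>\<close>-algebra, and Kolmogorov's law applies.\<close>
lemma drifts_down_0_1:
  "prob {\<omega>\<in>space M. drifts_down (\<lambda>i. Z i \<omega>)} = 0 \<or> prob {\<omega>\<in>space M. drifts_down (\<lambda>i. Z i \<omega>)} = 1"
proof (rule kolmogorov_0_1_law)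
  let ?A = "\<lambda>i. sigma_sets (space M) {Z i -` B \<inter> space M |B. B \<in> sets borel}"
  show "sigma_algebra (space M) (?A i)" for i
    by (rule sigma_algebra_sigma_sets) auto
  show "indep_sets ?A UNIV"
    using indep by (simp add: indep_vars_def)
  show "{\<omega>\<in>space M. drifts_down (\<lambda>i. Z i \<omega>)} \<in> tail_events ?A"
    unfolding tail_events_def
  proof
    fix m :: nat
    let ?N = "sigma (space M) (\<Union> (?A ` {m..}))"
    have sub: "\<Union> (?A ` {m..}) \<subseteq> Pow (space M)"
    proof
      fix B assume "B \<in> \<Union> (?A ` {m..})"
      then obtain i where "B \<in> ?A i" by blast
      then show "B \<in> Pow (space M)"
        using sigma_sets_into_sp[of "{Z i -` B \<inter> space M |B. B \<in> sets borel}" "space M" B] by blast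
    qed
    have Zm: "Z i \<in> borel_measurable ?N" if "m \<le> i" for i
    proof (rule measurableI)
      fix B :: "real set" assume "B \<in> sets borel"
      then have "Z i -` B \<inter> space M \<in> \<Union> (?A ` {m..})"
        using that by (intro UN_I[of i] sigma_sets.Basic) auto
      then show "Z i -` B \<inter> space ?N \<in> sets ?N"
        by (simp only: space_measure_of[OF sub] sets_measure_of[OF sub] sigma_sets.Basic)
    qed simp
    define Y where "Y i = (if m \<le> i then Z i else (\<lambda>_. 0))" for i
    have [measurable]: "Y i \<in> borel_measurable ?N" for i
      using Zm by (simp add: Y_def)
    have "drifts_down (\<lambda>i. Z i \<omega>) \<longleftrightarrow> drifts_down (\<lambda>i. Y i \<omega>)" for \<omega>
    proof
      assume "drifts_down (\<lambda>i. Z i \<omega>)"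
      then show "drifts_down (\<lambda>i. Y i \<omega>)"
        by (rule drifts_down_cong_tail[of m, rotated]) (simp add: Y_def)
    next
      assume "drifts_down (\<lambda>i. Y i \<omega>)"
      then show "drifts_down (\<lambda>i. Z i \<omega>)"
        by (rule drifts_down_cong_tail[of m, rotated]) (simp add: Y_def)
    qed
    moreover have "space ?N = space M"
      using sub by (rule space_measure_of)
    ultimately have "{\<omega>\<in>space M. drifts_down (\<lambda>i. Z i \<omega>)} =
        {\<omega>\<in>space ?N. drifts_down (\<lambda>i. Y i \<omega>)}"
      by simp
    also have "\<dots> \<in> sets ?N"
      unfolding drifts_down_def by measurable
    finally show "{\<omega>\<in>space M. drifts_down (\<lambda>i. Z i \<omega>)} \<in> sigma_sets (space M) (\<Union> (?A ` {m..}))"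
      using sub by (simp add: sets_measure_of)
  qed
qed

text \<open>One half of the strong law of large numbers. If the partial sums did not drift down, then by the
zero-one law they would almost surely fail to do so at every rate. Adding a small constant to each
variable would then make some partial sum positive almost surely while the mean stays negative,
against the maximal ergodic inequality.\<close>
theorem sums_eventually_negative:
  assumes int: "integrable M (Z 0)" and neg: "expectation (Z 0) < 0"
  shows "AE \<omega> in M. \<forall>\<^sub>F n in sequentially. (\<Sum>i<n. Z i \<omega>) < 0"
proof -
  have meas: "{\<omega>\<in>space M. drifts_down (\<lambda>i. Z i \<omega>)} \<in> sets M"
    unfolding drifts_down_def by measurable
  have "prob {\<omega>\<in>space M. drifts_down (\<lambda>i. Z i \<omega>)} \<noteq> 0"
  proof
    assume "prob {\<omega>\<in>space M. drifts_down (\<lambda>i. Z i \<omega>)} = 0"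
    then have nodrift: "AE \<omega> in M. \<not> drifts_down (\<lambda>i. Z i \<omega>)"
    by (simp only: prob_Collect_eq_0[OF meas])
    \<comment> \<open>Adding \<open>2 / (k + 1)\<close> outweighs the rate \<open>1 / (k + 1)\<close> and leaves the mean negative.\<close>
    obtain k where "inverse (real (Suc k)) < - expectation (Z 0) / 2"
      using reals_Archimedean[of "- expectation (Z 0) / 2"] neg by auto
    then have k: "expectation (Z 0) + 2 / real (Suc k) < 0"
      by (simp add: inverse_eq_divide)
    interpret W: iid_sequence M "\<lambda>i \<omega>. Z i \<omega> + 2 / real (Suc k)"
      by (rule compose) auto
    have "AE \<omega> in M. \<exists>n. 0 < (\<Sum>i<n. Z i \<omega> + 2 / real (Suc k))"
      using nodrift
    proof eventually_elim
      fix \<omega> assume "\<not> drifts_down (\<lambda>i. Z i \<omega>)"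
      then have "\<exists>\<^sub>F n in sequentially. - (real n / real (Suc k)) \<le> (\<Sum>i<n. Z i \<omega>)"
        unfolding drifts_down_def by (auto simp: frequently_def not_le)
      then obtain n where n: "1 \<le> n" "- (real n / real (Suc k)) \<le> (\<Sum>i<n. Z i \<omega>)"
        unfolding frequently_sequentially by blast
      have "0 < real n / real (Suc k)"
        using n by simp
      also have "\<dots> \<le> (\<Sum>i<n. Z i \<omega> + 2 / real (Suc k))"
        using n by (simp add: sum.distrib)
      finally show "\<exists>n. 0 < (\<Sum>i<n. Z i \<omega> + 2 / real (Suc k))" by blast
    qed
    then have "0 \<le> expectation (\<lambda>\<omega>. Z 0 \<omega> + 2 / real (Suc k))"
      by (intro W.expectation_nonneg_of_recurrent) (use int in auto)
    with k int show False by (simp add: prob_space)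
  qed
  with drifts_down_0_1 have "prob {\<omega>\<in>space M. drifts_down (\<lambda>i. Z i \<omega>)} = 1"
    by blast
  then have "AE \<omega> in M. drifts_down (\<lambda>i. Z i \<omega>)"
    by (simp only: prob_Collect_eq_1[OF meas])
  then show ?thesis
  proof eventually_elim
    case (elim \<omega>)
    then obtain k where "\<forall>\<^sub>F n in sequentially. (\<Sum>i<n. Z i \<omega>) < - (real n / real (Suc k))"
      by (auto simp: drifts_down_def)
    then show ?case
      by eventually_elim (erule less_le_trans, simp)
  qed
qed

text \<open>The larger expectation may be infinite, as happens for the cost of a displaced level even when the
optimal cost is finite. So the larger function is cut off at a level where its expectation already
exceeds the smaller one, and the half of the strong law above applies to the difference.\<close>
theorem sums_eventually_less:
  fixes f\<^sub>1 f\<^sub>2 :: "real \<Rightarrow> real"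
  assumes [measurable]: "f\<^sub>1 \<in> borel_measurable borel" "f\<^sub>2 \<in> borel_measurable borel"
    and nn: "\<And>x. 0 \<le> f\<^sub>1 x" "\<And>x. 0 \<le> f\<^sub>2 x"
    and less: "(\<integral>\<^sup>+\<omega>. f\<^sub>1 (Z 0 \<omega>) \<partial>M) < (\<integral>\<^sup>+\<omega>. f\<^sub>2 (Z 0 \<omega>) \<partial>M)"
  shows "AE \<omega> in M. \<forall>\<^sub>F n in sequentially. (\<Sum>i<n. f\<^sub>1 (Z i \<omega>)) < (\<Sum>i<n. f\<^sub>2 (Z i \<omega>))"
proof -
  have int1: "integrable M (\<lambda>\<omega>. f\<^sub>1 (Z 0 \<omega>))"
  proof (rule integrableI_nonneg)
    show "(\<integral>\<^sup>+\<omega>. f\<^sub>1 (Z 0 \<omega>) \<partial>M) < \<infinity>"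
      unfolding infinity_ennreal_def by (rule order.strict_trans2[OF less top_greatest])
    show "AE \<omega> in M. 0 \<le> f\<^sub>1 (Z 0 \<omega>)"
      by (rule AE_I2) (rule nn)
    show "(\<lambda>\<omega>. f\<^sub>1 (Z 0 \<omega>)) \<in> borel_measurable M"
      by measurable
  qed
  define t where "t K x = min (f\<^sub>2 x) (real K)" for K x
  have [measurable]: "t K \<in> borel_measurable borel" for K
    by (simp add: t_def[abs_def])
  have "(\<lambda>K. \<integral>\<^sup>+\<omega>. t K (Z 0 \<omega>) \<partial>M) \<longlonglongrightarrow> (\<integral>\<^sup>+\<omega>. f\<^sub>2 (Z 0 \<omega>) \<partial>M)"
  proof (rule nn_integral_LIMSEQ)
    show "incseq (\<lambda>K \<omega>. ennreal (t K (Z 0 \<omega>)))"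
      by (auto simp: incseq_def le_fun_def t_def intro!: ennreal_leI)
    fix \<omega>
    obtain K0 where "f\<^sub>2 (Z 0 \<omega>) \<le> real K0"
      using real_arch_simple[of "f\<^sub>2 (Z 0 \<omega>)"] by (elim exE)
    then have "\<forall>\<^sub>F K in sequentially. ennreal (t K (Z 0 \<omega>)) = ennreal (f\<^sub>2 (Z 0 \<omega>))"
      by (intro eventually_sequentiallyI[of K0]) (simp add: t_def)
    then show "(\<lambda>K. ennreal (t K (Z 0 \<omega>))) \<longlonglongrightarrow> ennreal (f\<^sub>2 (Z 0 \<omega>))"
      by (rule tendsto_eventually)
  qed auto
  from eventually_happens'[OF sequentially_bot order_tendstoD(1)[OF this less]] obtain K
    where K: "(\<integral>\<^sup>+\<omega>. f\<^sub>1 (Z 0 \<omega>) \<partial>M) < (\<integral>\<^sup>+\<omega>. t K (Z 0 \<omega>) \<partial>M)"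
    by (elim exE)
  have int2: "integrable M (\<lambda>\<omega>. t K (Z 0 \<omega>))"
    using nn by (intro integrable_const_bound[of _ "real K"]) (auto simp: t_def)
  have "ennreal (expectation (\<lambda>\<omega>. f\<^sub>1 (Z 0 \<omega>))) < ennreal (expectation (\<lambda>\<omega>. t K (Z 0 \<omega>)))"
    using K nn nn_integral_eq_integral[OF int1] nn_integral_eq_integral[OF int2] by (simp add: t_def)
  then have lt: "expectation (\<lambda>\<omega>. f\<^sub>1 (Z 0 \<omega>)) < expectation (\<lambda>\<omega>. t K (Z 0 \<omega>))"
    using nn by (simp add: ennreal_less_iff)
  interpret D: iid_sequence M "\<lambda>i \<omega>. f\<^sub>1 (Z i \<omega>) - t K (Z i \<omega>)"
    using compose[of "\<lambda>x. f\<^sub>1 x - t K x"] by simp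
  have "AE \<omega> in M. \<forall>\<^sub>F n in sequentially. (\<Sum>i<n. f\<^sub>1 (Z i \<omega>) - t K (Z i \<omega>)) < 0"
    by (rule D.sums_eventually_negative) (use int1 int2 lt in auto)
  then show ?thesis
  proof eventually_elim
    case (elim \<omega>)
    then show ?case
    proof eventually_elim
      case (elim n)
      have "(\<Sum>i<n. t K (Z i \<omega>)) \<le> (\<Sum>i<n. f\<^sub>2 (Z i \<omega>))"
        by (rule sum_mono) (simp add: t_def)
      with elim show ?case by (simp add: sum_subtractf)
    qed
  qed
qed

end

section \<open>Quantile functions\<close>

text \<open>The uniform distribution on the open unit interval, on which every quantile function lives.\<close>
definition unit_lebesgue :: "real measure" where
  "unit_lebesgue = restrict_space lborel {0<..<1}"

definition quantile :: "real measure \<Rightarrow> real \<Rightarrow> real" where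
  "quantile \<mu> u = Inf {x. u \<le> cdf \<mu> x}"

lemma space_unit_lebesgue [simp]: "space unit_lebesgue = {0<..<1}"
  by (simp add: unit_lebesgue_def space_restrict_space)

lemma sets_unit_lebesgue [measurable_cong]: "sets unit_lebesgue = sets (restrict_space borel {0<..<1})"
  unfolding unit_lebesgue_def by (rule sets_restrict_space_cong) simp

lemma emeasure_unit_lebesgue:
  "A \<subseteq> {0<..<1} \<Longrightarrow> emeasure unit_lebesgue A = emeasure lborel A"
  unfolding unit_lebesgue_def by (rule emeasure_restrict_space) auto

interpretation unit_lebesgue: prob_space unit_lebesgue
  by (rule prob_spaceI) (simp add: emeasure_unit_lebesgue)

lemma AE_unit_lebesgue_iff: "(AE u in unit_lebesgue. Q u) \<longleftrightarrow> (AE u in lborel. 0 < u \<and> u < 1 \<longrightarrow> Q u)"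
  unfolding unit_lebesgue_def by (subst AE_restrict_space_iff) auto

lemma quantile_le_iff:
  assumes "real_distribution \<mu>" "0 < u" "u < 1"
  shows "quantile \<mu> u \<le> x \<longleftrightarrow> u \<le> cdf \<mu> x"
proof -
  interpret cdf_distribution \<mu>
    using assms(1) by (simp add: cdf_distribution_def)
  show ?thesis
    unfolding quantile_def by (rule pseudoinverse[OF assms(2,3), symmetric])
qed

lemma quantile_measurable [measurable]:
  assumes "real_distribution \<mu>"
  shows "quantile \<mu> \<in> borel_measurable unit_lebesgue"
proof -
  interpret cdf_distribution \<mu>
    using assms by (simp add: cdf_distribution_def)
  have "quantile \<mu> = (\<lambda>u. Inf {x. u \<le> cdf \<mu> x})"
    by (rule ext) (rule quantile_def)
  then show ?thesis
    using measurable_CI measurable_cong_sets[OF sets_unit_lebesgue refl] by metis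
qed

lemma distr_quantile:
  assumes "real_distribution \<mu>"
  shows "distr unit_lebesgue borel (quantile \<mu>) = \<mu>"
proof -
  interpret cdf_distribution \<mu>
    using assms by (simp add: cdf_distribution_def)
  have "quantile \<mu> = (\<lambda>u. Inf {x. u \<le> cdf \<mu> x})"
    by (rule ext) (rule quantile_def)
  then show ?thesis
    using distr_I_eq_M by (simp add: unit_lebesgue_def)
qed

lemma real_distribution_distr_unit_lebesgue:
  "f \<in> borel_measurable unit_lebesgue \<Longrightarrow> real_distribution (distr unit_lebesgue borel f)"
  by (simp add: real_distribution_def real_distribution_axioms_def unit_lebesgue.prob_space_distr)

section \<open>Optimal transport on the line for convex costs\<close>
lemma sets_coupling:
  "\<gamma> \<in> couplings \<mu> \<nu> \<Longrightarrow> sets \<gamma> = sets (borel \<Otimes>\<^sub>M borel :: (real \<times> real) measure)"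
  unfolding couplings_def borel_prod by simp

text \<open>Any two functions on the unit interval couple their laws.\<close>
lemma transport_cost_le_unit_lebesgue:
  assumes [measurable]: "f \<in> borel_measurable unit_lebesgue" "f' \<in> borel_measurable unit_lebesgue"
    "g \<in> borel_measurable borel"
  shows "transport_cost g (distr unit_lebesgue borel f) (distr unit_lebesgue borel f')
    \<le> (\<integral>\<^sup>+u. ennreal (g (f u - f' u)) \<partial>unit_lebesgue)"
proof -
  let ?\<gamma> = "distr unit_lebesgue (borel \<Otimes>\<^sub>M borel) (\<lambda>u. (f u, f' u))"
  have "prob_space ?\<gamma>"
    by (rule unit_lebesgue.prob_space_distr) simp
  moreover have "distr ?\<gamma> borel fst = distr unit_lebesgue borel f"
    by (subst distr_distr) (auto simp: comp_def)
  moreover have "distr ?\<gamma> borel snd = distr unit_lebesgue borel f'"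
    by (subst distr_distr) (auto simp: comp_def)
  ultimately have "?\<gamma> \<in> couplings (distr unit_lebesgue borel f) (distr unit_lebesgue borel f')"
    by (simp add: couplings_def borel_prod)
  then have "transport_cost g (distr unit_lebesgue borel f) (distr unit_lebesgue borel f')
      \<le> (\<integral>\<^sup>+ (x, y). ennreal (g (x - y)) \<partial>?\<gamma>)"
    unfolding transport_cost_def by (rule INF_lower)
  also have "\<dots> = (\<integral>\<^sup>+u. ennreal (g (f u - f' u)) \<partial>unit_lebesgue)"
    by (subst nn_integral_distr) auto
  finally show ?thesis .
qed

text \<open>The positive part of \<open>f - f' - s\<close> is the length of the interval \<open>[f' + s, f)\<close>; Tonelli's theorem
exchanges this length with the integral over \<open>p\<close>. The integral of a hinge function of \<open>f - f'\<close> is thereby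
expressed through probabilities of the events \<open>f' \<le> a \<and> b < f\<close>.\<close>
lemma nn_integral_excess:
  fixes \<gamma> :: "'a measure"
  assumes "sigma_finite_measure \<gamma>" and [measurable]: "f \<in> borel_measurable \<gamma>" "f' \<in> borel_measurable \<gamma>"
  shows "(\<integral>\<^sup>+p. ennreal (max 0 (f p - f' p - s)) \<partial>\<gamma>) =
    (\<integral>\<^sup>+z. emeasure \<gamma> {p\<in>space \<gamma>. f' p \<le> z - s \<and> z < f p} \<partial>lborel)"
proof -
  interpret pair_sigma_finite \<gamma> lborel
    by (simp add: pair_sigma_finite_def assms lborel.sigma_finite_measure_axioms)
  have [measurable]: "Measurable.pred (\<gamma> \<Otimes>\<^sub>M lborel) (\<lambda>(p, z). f' p \<le> z - s \<and> z < f p)"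
    by measurable
  have "ennreal (max 0 (f p - f' p - s)) = (\<integral>\<^sup>+z. indicator {(p, z). f' p \<le> z - s \<and> z < f p} (p, z) \<partial>lborel)" for p
  proof -
    have "(\<integral>\<^sup>+z. indicator {(p, z). f' p \<le> z - s \<and> z < f p} (p, z) \<partial>lborel) =
        (\<integral>\<^sup>+z. indicator {f' p + s..<f p} z \<partial>lborel)"
      by (rule nn_integral_cong) (auto split: split_indicator)
    also have "\<dots> = emeasure lborel {f' p + s..<f p}"
      by simp
    also have "\<dots> = ennreal (max 0 (f p - f' p - s))"
      by (cases "f' p + s \<le> f p") (auto simp: max_def algebra_simps)
    finally show ?thesis by simp
  qed
  then have "(\<integral>\<^sup>+p. ennreal (max 0 (f p - f' p - s)) \<partial>\<gamma>) =
      (\<integral>\<^sup>+p. \<integral>\<^sup>+z. indicator {(p, z). f' p \<le> z - s \<and> z < f p} (p, z) \<partial>lborel \<partial>\<gamma>)"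
    by simp
  also have "\<dots> = (\<integral>\<^sup>+z. \<integral>\<^sup>+p. indicator {(p, z). f' p \<le> z - s \<and> z < f p} (p, z) \<partial>\<gamma> \<partial>lborel)"
    by (rule Fubini'[symmetric]) measurable
  also have "\<dots> = (\<integral>\<^sup>+z. emeasure \<gamma> {p\<in>space \<gamma>. f' p \<le> z - s \<and> z < f p} \<partial>lborel)"
  proof (rule nn_integral_cong)
    fix z
    have "(\<integral>\<^sup>+p. indicator {(p, z). f' p \<le> z - s \<and> z < f p} (p, z) \<partial>\<gamma>) =
        (\<integral>\<^sup>+p. indicator {p\<in>space \<gamma>. f' p \<le> z - s \<and> z < f p} p \<partial>\<gamma>)"
      by (rule nn_integral_cong) (auto split: split_indicator)
    then show "(\<integral>\<^sup>+p. indicator {(p, z). f' p \<le> z - s \<and> z < f p} (p, z) \<partial>\<gamma>) =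
        emeasure \<gamma> {p\<in>space \<gamma>. f' p \<le> z - s \<and> z < f p}"
      by simp
  qed
  finally show ?thesis .
qed

text \<open>Under every coupling the event \<open>y \<le> a \<and> b < x\<close> has probability at least \<open>cdf \<nu> a - cdf \<mu> b\<close>,
whereas for the pair of quantile functions the corresponding set is contained in the interval
between \<open>cdf \<mu> b\<close> and \<open>cdf \<nu> a\<close>. So the quantile coupling minimises each of these probabilities,
and with them the integral of every hinge function.\<close>
lemma excess_quantile_le_coupling:
  assumes \<mu>: "real_distribution \<mu>" and \<nu>: "real_distribution \<nu>" and \<gamma>: "\<gamma> \<in> couplings \<mu> \<nu>"
  shows "(\<integral>\<^sup>+u. ennreal (max 0 (quantile \<mu> u - quantile \<nu> u - s)) \<partial>unit_lebesgue)
    \<le> (\<integral>\<^sup>+p. ennreal (max 0 (fst p - snd p - s)) \<partial>\<gamma>)"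
proof -
  interpret \<gamma>: prob_space \<gamma>
    using \<gamma> by (simp add: couplings_def)
  note [measurable_cong] = sets_coupling[OF \<gamma>]
  note [measurable] = quantile_measurable[OF \<mu>] quantile_measurable[OF \<nu>]
  have sp: "space \<gamma> = UNIV"
    using sets_eq_imp_space_eq[OF sets_coupling[OF \<gamma>]] by (simp add: space_pair_measure)
  have fst: "measure \<gamma> {p. fst p \<le> b} = cdf \<mu> b" for b
  proof -
    have "cdf \<mu> b = measure (distr \<gamma> borel fst) {..b}"
      using \<gamma> by (simp add: couplings_def cdf_def)
    also have "\<dots> = measure \<gamma> {p. fst p \<le> b}"
      by (subst measure_distr) (auto simp: sp vimage_def)
    finally show ?thesis by simp
  qed
  have snd: "measure \<gamma> {p. snd p \<le> b} = cdf \<nu> b" for b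
  proof -
    have "cdf \<nu> b = measure (distr \<gamma> borel snd) {..b}"
      using \<gamma> by (simp add: couplings_def cdf_def)
    also have "\<dots> = measure \<gamma> {p. snd p \<le> b}"
      by (subst measure_distr) (auto simp: sp vimage_def)
    finally show ?thesis by simp
  qed
  have "emeasure unit_lebesgue {u\<in>space unit_lebesgue. quantile \<nu> u \<le> a \<and> b < quantile \<mu> u}
      \<le> emeasure \<gamma> {p\<in>space \<gamma>. snd p \<le> a \<and> b < fst p}" for a b
  proof -
    have sets: "{p. fst p \<le> b} \<in> sets \<gamma>" "{p. snd p \<le> a} \<in> sets \<gamma>" "{p. snd p \<le> a \<and> b < fst p} \<in> sets \<gamma>"
    proof -
      have "{p\<in>space \<gamma>. fst p \<le> b} \<in> sets \<gamma>" by measurable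
      then show "{p. fst p \<le> b} \<in> sets \<gamma>" by (simp add: sp)
      have "{p\<in>space \<gamma>. snd p \<le> a} \<in> sets \<gamma>" by measurable
      then show "{p. snd p \<le> a} \<in> sets \<gamma>" by (simp add: sp)
      have "{p\<in>space \<gamma>. snd p \<le> a \<and> b < fst p} \<in> sets \<gamma>" by measurable
      then show "{p. snd p \<le> a \<and> b < fst p} \<in> sets \<gamma>" by (simp add: sp)
    qed
    have "cdf \<nu> a \<le> measure \<gamma> ({p. snd p \<le> a \<and> b < fst p} \<union> {p. fst p \<le> b})"
      unfolding snd[symmetric] using sets by (intro \<gamma>.finite_measure_mono) auto
    also have "\<dots> \<le> measure \<gamma> {p. snd p \<le> a \<and> b < fst p} + cdf \<mu> b"
      unfolding fst[symmetric] using sets by (intro measure_Un_le)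
    finally have le: "cdf \<nu> a - cdf \<mu> b \<le> measure \<gamma> {p. snd p \<le> a \<and> b < fst p}"
      by simp
    have sub: "{u\<in>space unit_lebesgue. quantile \<nu> u \<le> a \<and> b < quantile \<mu> u} \<subseteq> {cdf \<mu> b<..cdf \<nu> a}"
      using quantile_le_iff[OF \<mu>] quantile_le_iff[OF \<nu>] by (auto simp: not_le[symmetric])
    have "emeasure unit_lebesgue {u\<in>space unit_lebesgue. quantile \<nu> u \<le> a \<and> b < quantile \<mu> u}
        = emeasure lborel {u\<in>space unit_lebesgue. quantile \<nu> u \<le> a \<and> b < quantile \<mu> u}"
      by (rule emeasure_unit_lebesgue) auto
    also have "\<dots> \<le> emeasure lborel {cdf \<mu> b<..cdf \<nu> a}"
      using sub by (rule emeasure_mono) simp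
    also have "\<dots> \<le> ennreal (measure \<gamma> {p. snd p \<le> a \<and> b < fst p})"
      using le by (cases "cdf \<mu> b \<le> cdf \<nu> a") (auto intro: ennreal_leI)
    finally show ?thesis
      by (simp add: \<gamma>.emeasure_eq_measure sp)
  qed
  then show ?thesis
    unfolding nn_integral_excess[OF unit_lebesgue.sigma_finite_measure_axioms quantile_measurable[OF \<mu>] quantile_measurable[OF \<nu>]]
    by (subst nn_integral_excess) (auto intro!: nn_integral_mono \<gamma>.sigma_finite_measure_axioms)
qed

lemma swap_coupling:
  assumes \<gamma>: "\<gamma> \<in> couplings \<mu> \<nu>"
  shows "distr \<gamma> (borel \<Otimes>\<^sub>M borel) prod.swap \<in> couplings \<nu> \<mu>"
proof -
  note [measurable_cong] = sets_coupling[OF \<gamma>]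
  interpret \<gamma>: prob_space \<gamma>
    using \<gamma> by (simp add: couplings_def)
  have [measurable]: "prod.swap \<in> \<gamma> \<rightarrow>\<^sub>M borel \<Otimes>\<^sub>M borel"
    unfolding prod.swap_def by measurable
  have "prob_space (distr \<gamma> (borel \<Otimes>\<^sub>M borel) prod.swap)"
    by (rule \<gamma>.prob_space_distr) measurable
  moreover have "distr (distr \<gamma> (borel \<Otimes>\<^sub>M borel) prod.swap) borel fst = \<nu>"
    using \<gamma> by (subst distr_distr) (auto simp: couplings_def comp_def)
  moreover have "distr (distr \<gamma> (borel \<Otimes>\<^sub>M borel) prod.swap) borel snd = \<mu>"
    using \<gamma> by (subst distr_distr) (auto simp: couplings_def comp_def)
  ultimately show ?thesis
    unfolding couplings_def borel_prod by simp
qed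

text \<open>The scaled second difference of \<open>g\<close> at the grid point \<open>k h\<close>. With \<open>g 0 = 0\<close> these are the increments
of slope of the piecewise linear interpolation of \<open>g\<close> on the positive half-line; the entry at \<open>0\<close> is
its initial slope.\<close>
definition hinge_weight :: "(real \<Rightarrow> real) \<Rightarrow> real \<Rightarrow> nat \<Rightarrow> real" where
  "hinge_weight g h k =
    (if k = 0 then g h else g (real (Suc k) * h) - 2 * g (real k * h) + g (real (k - 1) * h)) / h"

text \<open>The piecewise linear interpolation of \<open>g\<close> with mesh \<open>h\<close>, moved to the right by \<open>h\<close>. Interpolating a
convex function overestimates it; the displacement turns this into a lower bound for
\<open>g\<close> on the positive half-line, since \<open>g\<close> increases there.\<close>
definition hinge_sum :: "(real \<Rightarrow> real) \<Rightarrow> real \<Rightarrow> real \<Rightarrow> ennreal" where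
  "hinge_sum g h t = (\<Sum>k. ennreal (hinge_weight g h k) * ennreal (max 0 (t - real (Suc k) * h)))"

lemma hinge_sum_mono: "s \<le> t \<Longrightarrow> hinge_sum g h s \<le> hinge_sum g h t"
  unfolding hinge_sum_def by (intro suminf_le mult_left_mono ennreal_leI) auto

lemma hinge_sum_measurable [measurable]: "hinge_sum g h \<in> borel_measurable borel"
  unfolding hinge_sum_def[abs_def] by measurable

text \<open>Summation by parts: the partial sums of the weights telescope to the slopes of the interpolation,
whose increments sum up to \<open>g\<close>.\<close>
lemma sum_hinge_weight:
  assumes "g 0 = 0" "0 < h"
  shows "(\<Sum>k<m. hinge_weight g h k * (real (m - k) * h)) = g (real m * h)"
proof (induction m)
  case 0
  then show ?case using assms by simp
next
  case (Suc m)
  \<comment> \<open>The slope of the interpolation on the interval from \<open>m h\<close> to \<open>(m + 1) h\<close>.\<close>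
  have incr: "(\<Sum>k<Suc m. hinge_weight g h k * h) = g (real (Suc m) * h) - g (real m * h)"
    using assms by (induction m) (auto simp: hinge_weight_def)
  have "(\<Sum>k<Suc m. hinge_weight g h k * (real (Suc m - k) * h)) =
      (\<Sum>k<Suc m. hinge_weight g h k * (real (m - k) * h) + hinge_weight g h k * h)"
    by (rule sum.cong) (auto simp: of_nat_diff algebra_simps)
  also have "\<dots> = (\<Sum>k<m. hinge_weight g h k * (real (m - k) * h)) + (\<Sum>k<Suc m. hinge_weight g h k * h)"
    by (simp add: sum.distrib)
  also have "\<dots> = g (real (Suc m) * h)"
    unfolding incr Suc.IH by simp
  finally show ?case .
qed

locale transport_profile =
  fixes g :: "real \<Rightarrow> real"
  assumes convex: "convex_on UNIV g"
    and min_at_0: "g 0 \<le> g x"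
    and zero [simp]: "g 0 = 0"
begin

lemma nonneg [simp]: "0 \<le> g x"
  using min_at_0[of x] by simp

lemma profile_continuous: "continuous_on UNIV g"
  by (rule convex_on_continuous) (use convex in auto)

lemma profile_measurable [measurable]: "g \<in> borel_measurable borel"
  by (rule borel_measurable_continuous_onI[OF profile_continuous])

lemma mono_nonneg:
  assumes "0 \<le> s" "s \<le> t"
  shows "g s \<le> g t"
proof (cases "t = 0")
  case False
  then have t: "0 < t" using assms by simp
  have "g ((1 - s / t) *\<^sub>R 0 + (s / t) *\<^sub>R t) \<le> (1 - s / t) * g 0 + (s / t) * g t"
    using assms t by (intro convex_onD[OF convex]) auto
  also have "\<dots> \<le> g t"
    using assms t mult_left_le_one_le[of "g t" "s / t"] by simp
  finally show ?thesis using t by simp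
qed (use assms in auto)

lemma hinge_weight_nonneg:
  assumes "0 < h"
  shows "0 \<le> hinge_weight g h k"
proof (cases k)
  case (Suc l)
  have "g ((1 - 1/2) *\<^sub>R (real l * h) + (1/2) *\<^sub>R (real (Suc (Suc l)) * h))
      \<le> (1 - 1/2) * g (real l * h) + (1/2) * g (real (Suc (Suc l)) * h)"
    by (intro convex_onD[OF convex]) auto
  then have "2 * g (real k * h) \<le> g (real l * h) + g (real (Suc k) * h)"
    using Suc by (simp add: algebra_simps add_divide_distrib)
  then show ?thesis
    using assms Suc by (simp add: hinge_weight_def)
qed (use assms in \<open>simp add: hinge_weight_def\<close>)

lemma hinge_sum_grid:
  assumes h: "0 < h"
  shows "hinge_sum g h (real (Suc m) * h) = ennreal (g (real m * h))"
proof -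
  have "hinge_sum g h (real (Suc m) * h) =
      (\<Sum>k<m. ennreal (hinge_weight g h k) * ennreal (max 0 (real (Suc m) * h - real (Suc k) * h)))"
    unfolding hinge_sum_def
  proof (rule suminf_finite)
    fix k assume "k \<notin> {..<m}"
    then have "real (Suc m) * h \<le> real (Suc k) * h"
      using h by (intro mult_right_mono) auto
    then show "ennreal (hinge_weight g h k) * ennreal (max 0 (real (Suc m) * h - real (Suc k) * h)) = 0"
      by (simp add: max_def)
  qed simp
  also have "\<dots> = (\<Sum>k<m. ennreal (hinge_weight g h k * (real (m - k) * h)))"
  proof (rule sum.cong[OF refl])
    fix k assume "k \<in> {..<m}"
    then have "real (Suc m) * h - real (Suc k) * h = real (m - k) * h"
      by (simp add: of_nat_diff algebra_simps)
    then show "ennreal (hinge_weight g h k) * ennreal (max 0 (real (Suc m) * h - real (Suc k) * h)) =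
        ennreal (hinge_weight g h k * (real (m - k) * h))"
      using h hinge_weight_nonneg[OF h, of k] by (simp add: ennreal_mult max_def)
  qed
  also have "\<dots> = ennreal (\<Sum>k<m. hinge_weight g h k * (real (m - k) * h))"
    using h hinge_weight_nonneg[OF h] by (intro sum_ennreal) auto
  also have "\<dots> = ennreal (g (real m * h))"
    using sum_hinge_weight[of g h m] zero h by simp
  finally show ?thesis .
qed

lemma hinge_sum_le:
  assumes h: "0 < h"
  shows "hinge_sum g h t \<le> ennreal (g (max 0 t))"
proof -
  define m where "m = nat \<lfloor>max 0 t / h\<rfloor>"
  have m: "real m \<le> max 0 t / h" "max 0 t / h < real (Suc m)"
    unfolding m_def using h by (auto intro!: of_nat_floor) linarith+
  then have "t \<le> real (Suc m) * h" "real m * h \<le> max 0 t"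
    using h by (auto simp: pos_divide_less_eq pos_le_divide_eq)
  then have "hinge_sum g h t \<le> hinge_sum g h (real (Suc m) * h)"
    by (intro hinge_sum_mono)
  also have "\<dots> \<le> ennreal (g (max 0 t))"
    unfolding hinge_sum_grid[OF h]
    using h \<open>real m * h \<le> max 0 t\<close> by (intro ennreal_leI mono_nonneg) auto
  finally show ?thesis .
qed

text \<open>The point \<open>s\<close> is the grid point of the interpolation at or before \<open>t - h\<close>, or \<open>0\<close> for small \<open>t\<close>.\<close>
lemma hinge_sum_ge:
  assumes h: "0 < h"
  obtains s where "max 0 t - 2 * h \<le> s" "s \<le> max 0 t" "ennreal (g s) \<le> hinge_sum g h t"
proof (cases "t < h")
  case True
  show ?thesis
    by (rule that[of 0]) (use True h in auto)
next
  case False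
  define m where "m = nat \<lfloor>t / h\<rfloor>"
  have m: "real m \<le> t / h" "t / h < real (Suc m)"
    unfolding m_def using h False by (auto intro!: of_nat_floor) linarith+
  have "1 \<le> m"
    unfolding m_def using h False by (simp add: le_nat_iff)
  then obtain l where l: "m = Suc l"
    by (cases m) auto
  have "real (Suc l) * h \<le> t" "t \<le> real (Suc (Suc l)) * h"
    using m h unfolding l by (auto simp: pos_divide_less_eq pos_le_divide_eq)
  then show ?thesis
    using hinge_sum_mono[of "real (Suc l) * h" t g h] h
    unfolding hinge_sum_grid[OF h] by (intro that[of "real l * h"]) (auto simp: algebra_simps)
qed

lemma hinge_sum_tendsto:
  "(\<lambda>n. hinge_sum g (1 / real (Suc n)) t) \<longlonglongrightarrow> ennreal (g (max 0 t))"
proof -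
  have "\<exists>s. max 0 t - 2 * (1 / real (Suc n)) \<le> s \<and> s \<le> max 0 t \<and>
      ennreal (g s) \<le> hinge_sum g (1 / real (Suc n)) t" for n
    by (rule hinge_sum_ge[of "1 / real (Suc n)" t]) auto
  then obtain s where s: "\<And>n. max 0 t - 2 * (1 / real (Suc n)) \<le> s n" "\<And>n. s n \<le> max 0 t"
      "\<And>n. ennreal (g (s n)) \<le> hinge_sum g (1 / real (Suc n)) t"
    by metis
  have lower: "(\<lambda>n. max 0 t - 2 * (1 / real (Suc n))) \<longlonglongrightarrow> max 0 t - 2 * 0"
    by (intro tendsto_intros LIMSEQ_Suc[OF lim_1_over_n])
  have "s \<longlonglongrightarrow> max 0 t"
  proof (rule tendsto_sandwich[OF _ _ _ tendsto_const])
    show "(\<lambda>n. max 0 t - 2 * (1 / real (Suc n))) \<longlonglongrightarrow> max 0 t"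
      using lower unfolding mult_zero_right diff_zero .
  qed (intro always_eventually allI s)+
  then have "(\<lambda>n. g (s n)) \<longlonglongrightarrow> g (max 0 t)"
    by (intro continuous_on_tendsto_compose[OF profile_continuous]) auto
  then have "(\<lambda>n. ennreal (g (s n))) \<longlonglongrightarrow> ennreal (g (max 0 t))"
    by (rule tendsto_ennrealI)
  then show ?thesis
    by (rule tendsto_sandwich[rotated 2, OF _ tendsto_const])
       (auto intro!: always_eventually s hinge_sum_le simp del: of_nat_Suc)
qed

text \<open>The quantile coupling is optimal for hinge functions, hence for their nonnegative countable
combinations \<open>hinge_sum\<close>; these lie below \<open>g\<close> and converge to it, so Fatou's lemma transfers
optimality to the part of \<open>g\<close> on the positive half-line.\<close>
lemma positive_part_quantile_le_coupling:
  assumes \<mu>: "real_distribution \<mu>" and \<nu>: "real_distribution \<nu>" and \<gamma>: "\<gamma> \<in> couplings \<mu> \<nu>"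
  shows "(\<integral>\<^sup>+u. ennreal (g (max 0 (quantile \<mu> u - quantile \<nu> u))) \<partial>unit_lebesgue)
    \<le> (\<integral>\<^sup>+p. ennreal (g (max 0 (fst p - snd p))) \<partial>\<gamma>)"
proof -
  note [measurable_cong] = sets_coupling[OF \<gamma>]
  note [measurable] = quantile_measurable[OF \<mu>] quantile_measurable[OF \<nu>]
  let ?h = "\<lambda>n. 1 / real (Suc n)"
  have le: "(\<integral>\<^sup>+u. hinge_sum g (?h n) (quantile \<mu> u - quantile \<nu> u) \<partial>unit_lebesgue)
      \<le> (\<integral>\<^sup>+p. ennreal (g (max 0 (fst p - snd p))) \<partial>\<gamma>)" for n
  proof -
    have "(\<integral>\<^sup>+u. hinge_sum g (?h n) (quantile \<mu> u - quantile \<nu> u) \<partial>unit_lebesgue) =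
        (\<Sum>k. ennreal (hinge_weight g (?h n) k) *
          (\<integral>\<^sup>+u. ennreal (max 0 (quantile \<mu> u - quantile \<nu> u - real (Suc k) * ?h n)) \<partial>unit_lebesgue))"
      unfolding hinge_sum_def by (simp add: nn_integral_suminf nn_integral_cmult del: of_nat_Suc)
    also have "\<dots> \<le> (\<Sum>k. ennreal (hinge_weight g (?h n) k) *
          (\<integral>\<^sup>+p. ennreal (max 0 (fst p - snd p - real (Suc k) * ?h n)) \<partial>\<gamma>))"
      by (intro suminf_le mult_left_mono excess_quantile_le_coupling[OF \<mu> \<nu> \<gamma>]) auto
    also have "\<dots> = (\<integral>\<^sup>+p. hinge_sum g (?h n) (fst p - snd p) \<partial>\<gamma>)"
      unfolding hinge_sum_def by (simp add: nn_integral_suminf nn_integral_cmult del: of_nat_Suc)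
    also have "\<dots> \<le> (\<integral>\<^sup>+p. ennreal (g (max 0 (fst p - snd p))) \<partial>\<gamma>)"
      by (intro nn_integral_mono hinge_sum_le) simp
    finally show ?thesis .
  qed
  have "(\<integral>\<^sup>+u. ennreal (g (max 0 (quantile \<mu> u - quantile \<nu> u))) \<partial>unit_lebesgue) =
      (\<integral>\<^sup>+u. liminf (\<lambda>n. hinge_sum g (?h n) (quantile \<mu> u - quantile \<nu> u)) \<partial>unit_lebesgue)"
    using lim_imp_Liminf[OF sequentially_bot hinge_sum_tendsto] by (simp del: of_nat_Suc)
  also have "\<dots> \<le> liminf (\<lambda>n. \<integral>\<^sup>+u. hinge_sum g (?h n) (quantile \<mu> u - quantile \<nu> u) \<partial>unit_lebesgue)"
    by (rule nn_integral_liminf) measurable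
  also have "\<dots> \<le> (\<integral>\<^sup>+p. ennreal (g (max 0 (fst p - snd p))) \<partial>\<gamma>)"
    using Liminf_mono[of _ "\<lambda>_. \<integral>\<^sup>+p. ennreal (g (max 0 (fst p - snd p))) \<partial>\<gamma>" sequentially]
    by (simp add: Liminf_const le del: of_nat_Suc)
  finally show ?thesis .
qed

lemma reflect: "transport_profile (\<lambda>x. g (- x))"
proof
  show "convex_on UNIV (\<lambda>x. g (- x))"
  proof (rule convex_onI)
    fix t x y :: real assume "0 < t" "t < 1"
    then show "g (- ((1 - t) *\<^sub>R x + t *\<^sub>R y)) \<le> (1 - t) * g (- x) + t * g (- y)"
      using convex_onD[OF convex, of t "- x" "- y"] by simp
  qed simp
qed (auto simp: min_at_0)

text \<open>Optimality of the quantile coupling for the whole profile: the part of \<open>g\<close> on the negative half-line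
is the positive part of the reflected profile, with the two marginals exchanged.\<close>
theorem transport_cost_eq:
  assumes \<mu>: "real_distribution \<mu>" and \<nu>: "real_distribution \<nu>"
  shows "transport_cost g \<mu> \<nu> = (\<integral>\<^sup>+u. ennreal (g (quantile \<mu> u - quantile \<nu> u)) \<partial>unit_lebesgue)"
proof (rule antisym)
  show "transport_cost g \<mu> \<nu> \<le> (\<integral>\<^sup>+u. ennreal (g (quantile \<mu> u - quantile \<nu> u)) \<partial>unit_lebesgue)"
    using transport_cost_le_unit_lebesgue[OF quantile_measurable[OF \<mu>] quantile_measurable[OF \<nu>] profile_measurable]
    by (simp add: distr_quantile \<mu> \<nu>)
  note [measurable] = quantile_measurable[OF \<mu>] quantile_measurable[OF \<nu>]
  have split: "ennreal (g t) = ennreal (g (max 0 t)) + ennreal (g (- max 0 (- t)))" for t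
    by (auto simp: max_def)
  show "(\<integral>\<^sup>+u. ennreal (g (quantile \<mu> u - quantile \<nu> u)) \<partial>unit_lebesgue) \<le> transport_cost g \<mu> \<nu>"
    unfolding transport_cost_def
  proof (rule INF_greatest)
    fix \<gamma> assume \<gamma>: "\<gamma> \<in> couplings \<mu> \<nu>"
    note [measurable_cong] = sets_coupling[OF \<gamma>]
    interpret refl: transport_profile "\<lambda>x. g (- x)"
      by (rule reflect)
    have [measurable]: "prod.swap \<in> \<gamma> \<rightarrow>\<^sub>M borel \<Otimes>\<^sub>M borel"
      unfolding prod.swap_def by measurable
    have neg: "(\<integral>\<^sup>+u. ennreal (g (- max 0 (quantile \<nu> u - quantile \<mu> u))) \<partial>unit_lebesgue)
        \<le> (\<integral>\<^sup>+p. ennreal (g (- max 0 (snd p - fst p))) \<partial>\<gamma>)"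
      using refl.positive_part_quantile_le_coupling[OF \<nu> \<mu> swap_coupling[OF \<gamma>]]
      by (simp add: nn_integral_distr)
    have "(\<integral>\<^sup>+u. ennreal (g (quantile \<mu> u - quantile \<nu> u)) \<partial>unit_lebesgue) =
        (\<integral>\<^sup>+u. ennreal (g (max 0 (quantile \<mu> u - quantile \<nu> u))) \<partial>unit_lebesgue) +
        (\<integral>\<^sup>+u. ennreal (g (- max 0 (quantile \<nu> u - quantile \<mu> u))) \<partial>unit_lebesgue)"
      by (subst split, subst nn_integral_add) auto
    also have "\<dots> \<le> (\<integral>\<^sup>+p. ennreal (g (max 0 (fst p - snd p))) \<partial>\<gamma>) +
        (\<integral>\<^sup>+p. ennreal (g (- max 0 (snd p - fst p))) \<partial>\<gamma>)"
      by (intro add_mono positive_part_quantile_le_coupling[OF \<mu> \<nu> \<gamma>] neg)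
    also have "\<dots> = (\<integral>\<^sup>+p. ennreal (g (fst p - snd p)) \<partial>\<gamma>)"
      by (subst split, subst nn_integral_add) auto
    finally show "(\<integral>\<^sup>+u. ennreal (g (quantile \<mu> u - quantile \<nu> u)) \<partial>unit_lebesgue)
        \<le> (\<integral>\<^sup>+(x, y). ennreal (g (x - y)) \<partial>\<gamma>)"
      by (simp add: case_prod_beta')
  qed
qed

end

section \<open>Quantiles of a random measure\<close>

lemma openin_subset_Pow: "{A. openin T A} \<subseteq> Pow (topspace T)"
  by (auto dest: openin_subset)

lemma space_weak_borel: "space weak_borel = {\<mu>. real_distribution \<mu>}"
  unfolding weak_borel_def space_measure_of[OF openin_subset_Pow] by (rule topspace_weak_topology)

lemma openin_sets_weak_borel: "openin weak_topology A \<Longrightarrow> A \<in> sets weak_borel"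
  unfolding weak_borel_def sets_measure_of[OF openin_subset_Pow] by (simp add: sigma_sets.Basic)

lemma integral_measurable_weak_borel:
  fixes f :: "real \<Rightarrow> real"
  assumes "continuous_on UNIV f" "bounded (range f)"
  shows "(\<lambda>\<mu>. integral\<^sup>L \<mu> f) \<in> borel_measurable weak_borel"
proof (rule borel_measurableI)
  fix U :: "real set" assume "open U"
  have "openin weak_topology {\<mu>. real_distribution \<mu> \<and> integral\<^sup>L \<mu> f \<in> U}"
    unfolding weak_topology_def
    by (rule topology_generated_by_Basis) (use assms \<open>open U\<close> in blast)
  moreover have "(\<lambda>\<mu>. integral\<^sup>L \<mu> f) -` U \<inter> space weak_borel =
      {\<mu>. real_distribution \<mu> \<and> integral\<^sup>L \<mu> f \<in> U}"
    by (auto simp: space_weak_borel)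
  ultimately show "(\<lambda>\<mu>. integral\<^sup>L \<mu> f) -` U \<inter> space weak_borel \<in> sets weak_borel"
    by (simp add: openin_sets_weak_borel)
qed

text \<open>The functionals \<open>\<mu> \<mapsto> \<integral> f \<partial>\<mu>\<close> with \<open>f\<close> bounded and continuous are measurable by the definition of the
weak topology, and a distribution function is a pointwise limit of such functionals by
right-continuity.\<close>
lemma cdf_measurable_weak_borel [measurable]:
  "(\<lambda>\<mu>. cdf \<mu> x) \<in> borel_measurable weak_borel"
proof (rule borel_measurable_LIMSEQ_real)
  fix k :: nat
  have "continuous_on UNIV (cts_step x (x + 1 / real (Suc k)))"
    by (intro uniformly_continuous_imp_continuous cts_step_uniformly_continuous) simp
  moreover have "bounded (range (cts_step x (x + 1 / real (Suc k))))"
    unfolding bounded_iff by (intro exI[of _ 1]) (auto simp: cts_step_def divide_simps)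
  ultimately show "(\<lambda>\<mu>. integral\<^sup>L \<mu> (cts_step x (x + 1 / real (Suc k)))) \<in> borel_measurable weak_borel"
    by (rule integral_measurable_weak_borel)
next
  fix \<mu> assume "\<mu> \<in> space weak_borel"
  then interpret real_distribution \<mu> by (simp add: space_weak_borel)
  have "(\<lambda>k. x + 1 / real (Suc k)) \<longlonglongrightarrow> x + 0"
    by (intro tendsto_intros LIMSEQ_Suc[OF lim_1_over_n])
  then have "filterlim (\<lambda>k. x + 1 / real (Suc k)) (at_right x) sequentially"
    by (auto simp: filterlim_at intro!: always_eventually simp del: of_nat_Suc)
  moreover have "(cdf \<mu> \<longlongrightarrow> cdf \<mu> x) (at_right x)"
    using cdf_is_right_cont[of x] by (simp add: continuous_within)
  ultimately have "(\<lambda>k. cdf \<mu> (x + 1 / real (Suc k))) \<longlonglongrightarrow> cdf \<mu> x"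
    by (rule filterlim_compose[rotated])
  then show "(\<lambda>k. integral\<^sup>L \<mu> (cts_step x (x + 1 / real (Suc k)))) \<longlonglongrightarrow> cdf \<mu> x"
    by (rule tendsto_sandwich[rotated 2, OF tendsto_const])
       (auto intro!: always_eventually cdf_cts_step simp del: of_nat_Suc)
qed

lemma quantile_measurable_pair [measurable]:
  "(\<lambda>(\<mu>, u). quantile \<mu> u) \<in> borel_measurable (weak_borel \<Otimes>\<^sub>M unit_lebesgue)"
proof (subst borel_measurable_iff_le, rule allI)
  fix x :: real
  have "{p \<in> space (weak_borel \<Otimes>\<^sub>M unit_lebesgue). (case p of (\<mu>, u) \<Rightarrow> quantile \<mu> u) \<le> x} =
      {p \<in> space (weak_borel \<Otimes>\<^sub>M unit_lebesgue). snd p \<le> cdf (fst p) x}"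
    using quantile_le_iff by (auto simp: space_pair_measure space_weak_borel)
  also have "\<dots> \<in> sets (weak_borel \<Otimes>\<^sub>M unit_lebesgue)"
  proof -
    have [measurable]: "(\<lambda>u. u) \<in> borel_measurable unit_lebesgue"
      by (simp add: measurable_cong_sets[OF sets_unit_lebesgue refl] measurable_restrict_space1)
    show ?thesis by measurable
  qed
  finally show "{p \<in> space (weak_borel \<Otimes>\<^sub>M unit_lebesgue). (case p of (\<mu>, u) \<Rightarrow> quantile \<mu> u) \<le> x}
      \<in> sets (weak_borel \<Otimes>\<^sub>M unit_lebesgue)" .
qed

lemma quantile_measurable_weak_borel [measurable]:
  assumes "0 < u" "u < 1"
  shows "(\<lambda>\<mu>. quantile \<mu> u) \<in> borel_measurable weak_borel"
proof -
  have "(\<lambda>\<mu>. (\<lambda>(\<mu>, u). quantile \<mu> u) (\<mu>, u)) \<in> borel_measurable weak_borel"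
    by (rule measurable_Pair_compose_split[OF _ measurable_ident_sets[OF refl] measurable_const])
       (use assms in \<open>auto intro: quantile_measurable_pair[unfolded case_prod_beta']\<close>)
  then show ?thesis by simp
qed

lemma quantile_mono:
  assumes \<mu>: "real_distribution \<mu>" and "0 < u" "u \<le> v" "v < 1"
  shows "quantile \<mu> u \<le> quantile \<mu> v"
  using quantile_le_iff[OF \<mu>, of v "quantile \<mu> v"] quantile_le_iff[OF \<mu>, of u "quantile \<mu> v"] assms
  by simp

section \<open>Strictly convex profiles\<close>
locale strict_transport_profile =
  fixes g :: "real \<Rightarrow> real"
  assumes strict: "strictly_convex g"
    and min_0: "g 0 \<le> g x"
    and zero_0: "g 0 = 0"
begin

sublocale transport_profile g
proof
  show "convex_on UNIV g"
  proof (rule convex_onI)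
    fix t x y :: real assume t: "0 < t" "t < 1"
    show "g ((1 - t) *\<^sub>R x + t *\<^sub>R y) \<le> (1 - t) * g x + t * g y"
    proof (cases "x = y")
      case True
      then show ?thesis by (simp add: algebra_simps)
    next
      case False
      then have "g ((1 - t) * x + (1 - (1 - t)) * y) < (1 - t) * g x + (1 - (1 - t)) * g y"
        using strict t unfolding strictly_convex_def by (metis diff_gt_0_iff_gt diff_less_eq less_add_same_cancel1)
      then show ?thesis by simp
    qed
  qed simp
qed (use min_0 zero_0 in auto)

lemma midpoint_less:
  assumes "x \<noteq> y"
  shows "g ((x + y) / 2) < (g x + g y) / 2"
proof -
  have "g ((1/2) * x + (1 - 1/2) * y) < (1/2) * g x + (1 - 1/2) * g y"
    using strict assms unfolding strictly_convex_def by (metis half_gt_zero_iff less_numeral_extra(1) field_sum_of_halves less_add_same_cancel1)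
  then show ?thesis by (simp add: add_divide_distrib)
qed

text \<open>By strictness both \<open>g 1\<close> and \<open>g (-1)\<close> are positive, and convexity extends the resulting slopes.\<close>
lemma linear_growth:
  obtains a where "0 < a" "\<And>t. a * (\<bar>t\<bar> - 1) \<le> g t"
proof
  define a where "a = min (g 1) (g (-1))"
  have "0 < (g 1 + g 0) / 2" "0 < (g (- 1) + g 0) / 2"
    by (rule le_less_trans[OF nonneg midpoint_less]; simp)+
  then have "0 < g 1" "0 < g (- 1)" by simp_all
  then show "0 < a" by (simp add: a_def)
  show "a * (\<bar>t\<bar> - 1) \<le> g t" for t
  proof (cases "\<bar>t\<bar> \<le> 1")
    case True
    then have "a * (\<bar>t\<bar> - 1) \<le> 0"
      using \<open>0 < a\<close> by (simp add: mult_le_0_iff)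
    then show ?thesis using nonneg[of t] by linarith
  next
    case False
    then have t: "1 < \<bar>t\<bar>" by simp
    have "g ((1 - 1 / \<bar>t\<bar>) *\<^sub>R 0 + (1 / \<bar>t\<bar>) *\<^sub>R t) \<le> (1 - 1 / \<bar>t\<bar>) * g 0 + (1 / \<bar>t\<bar>) * g t"
      using t by (intro convex_onD[OF convex]) auto
    then have "g (t / \<bar>t\<bar>) \<le> g t / \<bar>t\<bar>" by simp
    moreover have "a \<le> g (t / \<bar>t\<bar>)"
      using t by (auto simp: a_def abs_if)
    ultimately have "a \<le> g t / \<bar>t\<bar>" by simp
    then have "a * \<bar>t\<bar> \<le> g t"
      using t by (simp add: pos_le_divide_eq)
    then show ?thesis using \<open>0 < a\<close> by (simp add: right_diff_distrib)
  qed
qed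

text \<open>The arguments on the left lie between \<open>x - y'\<close> and \<open>x' - y\<close> and have the same sum, so convexity
applies to both with complementary weights.\<close>
lemma submodular:
  assumes "x \<le> x'" "y \<le> y'"
  shows "g (x - y) + g (x' - y') \<le> g (x - y') + g (x' - y)"
proof (cases "x = x' \<and> y = y'")
  case False
  define p s where "p = x - y'" and "s = x' - y"
  have ps: "p < s" using assms False by (auto simp: p_def s_def)
  define t where "t = (y' - y) / (s - p)"
  have t: "0 \<le> t" "t \<le> 1"
    using assms ps by (auto simp: t_def p_def s_def divide_le_eq)
  have "t * (s - p) = y' - y" using ps by (simp add: t_def)
  then have eq: "x - y = (1 - t) *\<^sub>R p + t *\<^sub>R s" "x' - y' = (1 - (1 - t)) *\<^sub>R p + (1 - t) *\<^sub>R s"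
    by (auto simp: p_def s_def algebra_simps)
  have "g (x - y) \<le> (1 - t) * g p + t * g s"
    unfolding eq(1) using t by (intro convex_onD[OF convex]) auto
  moreover have "g (x' - y') \<le> (1 - (1 - t)) * g p + (1 - t) * g s"
    unfolding eq(2) using t by (intro convex_onD[OF convex]) auto
  ultimately have "g (x - y) + g (x' - y') \<le> g p + g s"
    by (simp add: algebra_simps)
  then show ?thesis by (simp add: p_def s_def)
qed simp

end

context transport_profile
begin

lemma pair_measurable:
  assumes [measurable]: "f \<in> borel_measurable unit_lebesgue"
  shows "(\<lambda>p. ennreal (g (quantile (fst p) (snd p) - f (snd p)))) \<in> borel_measurable (weak_borel \<Otimes>\<^sub>M unit_lebesgue)"
proof -
  have [measurable]: "(\<lambda>p. quantile (fst p) (snd p)) \<in> borel_measurable (weak_borel \<Otimes>\<^sub>M unit_lebesgue)"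
    using quantile_measurable_pair by (simp add: case_prod_beta')
  show ?thesis by measurable
qed

lemma transport_cost_measurable:
  assumes \<nu>: "real_distribution \<nu>"
  shows "(\<lambda>\<mu>. transport_cost g \<mu> \<nu>) \<in> borel_measurable weak_borel"
proof -
  have "(\<lambda>\<mu>. \<integral>\<^sup>+u. ennreal (g (quantile \<mu> u - quantile \<nu> u)) \<partial>unit_lebesgue) \<in> borel_measurable weak_borel"
    using pair_measurable[OF quantile_measurable[OF \<nu>]]
    by (intro unit_lebesgue.borel_measurable_nn_integral) (simp add: case_prod_beta')
  then show ?thesis
    using transport_cost_eq[OF _ \<nu>] by (subst measurable_cong) (auto simp: space_weak_borel)
qed

end

section \<open>The barycenter of a law\<close>
locale random_measure_law = strict_transport_profile g + prob_space P
  for g :: "real \<Rightarrow> real" and P :: "real measure measure" +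
  assumes sets_P: "sets P = sets weak_borel"
begin

lemma sets_P_cong [measurable_cong]: "sets P = sets weak_borel"
  by (rule sets_P)

lemma space_P: "space P = {\<mu>. real_distribution \<mu>}"
  using sets_eq_imp_space_eq[OF sets_P] by (simp add: space_weak_borel)

sublocale pair: pair_sigma_finite P unit_lebesgue ..

text \<open>The expected cost of placing the \<open>u\<close>-quantile at \<open>y\<close>. Optimality of the quantile coupling makes the
expected transport cost to \<open>\<nu>\<close> the integral over \<open>u\<close> of the level cost at the \<open>u\<close>-quantile of \<open>\<nu>\<close>, so
that the barycenter problem separates into one real minimisation for each level. The value may be
infinite, even for all \<open>y\<close> but one.\<close>
definition level_cost :: "real \<Rightarrow> real \<Rightarrow> ennreal" where
  "level_cost u y = (\<integral>\<^sup>+\<mu>. ennreal (g (quantile \<mu> u - y)) \<partial>P)"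

definition level_minimizer :: "real \<Rightarrow> real \<Rightarrow> bool" where
  "level_minimizer u y \<longleftrightarrow> level_cost u y < \<infinity> \<and> (\<forall>z. level_cost u y \<le> level_cost u z)"

lemma quantile_P [measurable]: "0 < u \<Longrightarrow> u < 1 \<Longrightarrow> (\<lambda>\<mu>. quantile \<mu> u) \<in> borel_measurable P"
  by measurable

lemma pair_measurable_P:
  assumes [measurable]: "f \<in> borel_measurable unit_lebesgue"
  shows "(\<lambda>p. ennreal (g (quantile (fst p) (snd p) - f (snd p)))) \<in> borel_measurable (P \<Otimes>\<^sub>M unit_lebesgue)"
  using pair_measurable[OF assms] by (simp cong: measurable_cong_sets sets_pair_measure_cong)

lemma level_cost_measurable:
  assumes [measurable]: "f \<in> borel_measurable unit_lebesgue"
  shows "(\<lambda>u. level_cost u (f u)) \<in> borel_measurable unit_lebesgue"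
proof -
  have "(\<lambda>u. \<integral>\<^sup>+\<mu>. (\<lambda>p. ennreal (g (quantile (fst p) (snd p) - f (snd p)))) (\<mu>, u) \<partial>P)
      \<in> borel_measurable unit_lebesgue"
    using measurable_pair_swap[OF pair_measurable_P[OF assms]]
    by (intro borel_measurable_nn_integral) (simp add: case_prod_beta')
  then show ?thesis by (simp add: level_cost_def)
qed

lemma nn_integral_level_cost:
  assumes "f \<in> borel_measurable unit_lebesgue"
  shows "(\<integral>\<^sup>+\<mu>. \<integral>\<^sup>+u. ennreal (g (quantile \<mu> u - f u)) \<partial>unit_lebesgue \<partial>P) =
    (\<integral>\<^sup>+u. level_cost u (f u) \<partial>unit_lebesgue)"
  using pair.Fubini'[of "\<lambda>\<mu> u. ennreal (g (quantile \<mu> u - f u))"] pair_measurable_P[OF assms]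
  by (simp add: level_cost_def case_prod_beta')

lemma expected_cost_eq:
  assumes \<nu>: "real_distribution \<nu>"
  shows "(\<integral>\<^sup>+\<mu>. transport_cost g \<mu> \<nu> \<partial>P) = (\<integral>\<^sup>+u. level_cost u (quantile \<nu> u) \<partial>unit_lebesgue)"
proof -
  have "(\<integral>\<^sup>+\<mu>. transport_cost g \<mu> \<nu> \<partial>P) =
      (\<integral>\<^sup>+\<mu>. \<integral>\<^sup>+u. ennreal (g (quantile \<mu> u - quantile \<nu> u)) \<partial>unit_lebesgue \<partial>P)"
    using \<nu> by (intro nn_integral_cong transport_cost_eq) (auto simp: space_P)
  also have "\<dots> = (\<integral>\<^sup>+u. level_cost u (quantile \<nu> u) \<partial>unit_lebesgue)"
    by (rule nn_integral_level_cost) (rule quantile_measurable[OF \<nu>])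
  finally show ?thesis .
qed

context
  fixes u :: real
  assumes u: "0 < u" "u < 1"
begin

lemmas [measurable] = quantile_P[OF u]

lemma level_cost_lower_semicontinuous:
  assumes "s \<longlonglongrightarrow> y"
  shows "level_cost u y \<le> liminf (\<lambda>n. level_cost u (s n))"
proof -
  have conv: "(\<lambda>n. ennreal (g (quantile \<mu> u - s n))) \<longlonglongrightarrow> ennreal (g (quantile \<mu> u - y))" for \<mu>
    by (intro tendsto_ennrealI continuous_on_tendsto_compose[OF profile_continuous] tendsto_intros assms) auto
  have "level_cost u y = (\<integral>\<^sup>+\<mu>. liminf (\<lambda>n. ennreal (g (quantile \<mu> u - s n))) \<partial>P)"
    unfolding level_cost_def lim_imp_Liminf[OF sequentially_bot conv] ..
  also have "\<dots> \<le> liminf (\<lambda>n. level_cost u (s n))"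
    unfolding level_cost_def by (rule nn_integral_liminf) measurable
  finally show ?thesis .
qed

lemma level_cost_quasiconvex:
  assumes "x \<le> y" "y \<le> z"
  shows "level_cost u y \<le> max (level_cost u x) (level_cost u z)"
proof (cases "x = z")
  case False
  define t where "t = (y - x) / (z - x)"
  have t: "0 \<le> t" "t \<le> 1"
    using assms False by (auto simp: t_def divide_le_eq)
  have "t * (z - x) = y - x" using assms False by (simp add: t_def)
  then have y: "q - y = (1 - t) *\<^sub>R (q - x) + t *\<^sub>R (q - z)" for q
    by (simp add: algebra_simps)
  have "level_cost u y \<le> (\<integral>\<^sup>+\<mu>. ennreal (1 - t) * ennreal (g (quantile \<mu> u - x)) + ennreal t * ennreal (g (quantile \<mu> u - z)) \<partial>P)"
    unfolding level_cost_def
  proof (rule nn_integral_mono)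
    fix \<mu>
    have "g (quantile \<mu> u - y) \<le> (1 - t) * g (quantile \<mu> u - x) + t * g (quantile \<mu> u - z)"
      unfolding y using t by (intro convex_onD[OF convex]) auto
    then show "ennreal (g (quantile \<mu> u - y)) \<le>
        ennreal (1 - t) * ennreal (g (quantile \<mu> u - x)) + ennreal t * ennreal (g (quantile \<mu> u - z))"
      using t by (simp add: ennreal_mult[symmetric] ennreal_plus[symmetric] ennreal_leI del: ennreal_plus)
  qed
  also have "\<dots> = ennreal (1 - t) * level_cost u x + ennreal t * level_cost u z"
    unfolding level_cost_def by (simp add: nn_integral_add nn_integral_cmult)
  also have "\<dots> \<le> ennreal (1 - t) * max (level_cost u x) (level_cost u z) + ennreal t * max (level_cost u x) (level_cost u z)"
    by (intro add_mono mult_left_mono) auto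
  also have "\<dots> = max (level_cost u x) (level_cost u z)"
    using t by (simp add: distrib_right[symmetric] ennreal_plus[symmetric] del: ennreal_plus)
  finally show ?thesis .
qed (use assms in auto)

lemma level_cost_strict:
  assumes c: "level_cost u x \<le> c" "level_cost u y \<le> c" "c < \<infinity>" and "x \<noteq> y"
  shows "level_cost u ((x + y) / 2) < c"
proof -
  have fin: "level_cost u x < \<infinity>" "level_cost u y < \<infinity>"
    using c by (auto elim: order.strict_trans1)
  then have int [simp]: "integrable P (\<lambda>\<mu>. g (quantile \<mu> u - x))" "integrable P (\<lambda>\<mu>. g (quantile \<mu> u - y))"
    by (auto intro!: integrableI_nonneg simp: level_cost_def)
  have less: "g (quantile \<mu> u - (x + y) / 2) < (g (quantile \<mu> u - x) + g (quantile \<mu> u - y)) / 2" for \<mu>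
  proof -
    have eq: "quantile \<mu> u - (x + y) / 2 = ((quantile \<mu> u - x) + (quantile \<mu> u - y)) / 2"
      by (simp add: add_divide_distrib diff_divide_distrib)
    show ?thesis
      unfolding eq by (rule midpoint_less) (use \<open>x \<noteq> y\<close> in simp)
  qed
  have intm: "integrable P (\<lambda>\<mu>. g (quantile \<mu> u - (x + y) / 2))"
  proof (rule Bochner_Integration.integrable_bound)
    show "integrable P (\<lambda>\<mu>. (g (quantile \<mu> u - x) + g (quantile \<mu> u - y)) / 2)"
      by simp
    show "AE \<mu> in P. norm (g (quantile \<mu> u - (x + y) / 2)) \<le> norm ((g (quantile \<mu> u - x) + g (quantile \<mu> u - y)) / 2)"
      using less by (auto intro: less_imp_le)
  qed simp
  have eq: "level_cost u x = ennreal (expectation (\<lambda>\<mu>. g (quantile \<mu> u - x)))"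
    "level_cost u y = ennreal (expectation (\<lambda>\<mu>. g (quantile \<mu> u - y)))"
    "level_cost u ((x + y) / 2) = ennreal (expectation (\<lambda>\<mu>. g (quantile \<mu> u - (x + y) / 2)))"
    using intm by (simp_all add: level_cost_def nn_integral_eq_integral)
  obtain c' where c': "c = ennreal c'" "0 \<le> c'"
    using c(3) by (cases c) auto
  have "expectation (\<lambda>\<mu>. g (quantile \<mu> u - (x + y) / 2)) <
      expectation (\<lambda>\<mu>. (g (quantile \<mu> u - x) + g (quantile \<mu> u - y)) / 2)"
    by (rule integral_less_AE_space) (use less intm in \<open>auto simp: emeasure_space_1\<close>)
  also have "\<dots> = (expectation (\<lambda>\<mu>. g (quantile \<mu> u - x)) + expectation (\<lambda>\<mu>. g (quantile \<mu> u - y))) / 2"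
    by simp
  also have "\<dots> \<le> c'"
    using c(1,2) unfolding eq c' using c'(2) by (simp add: ennreal_le_iff)
  finally show ?thesis
    unfolding eq c'(1) by (simp add: ennreal_less_iff)
qed

lemma level_minimizer_unique:
  assumes "level_minimizer u x" "level_minimizer u y"
  shows "x = y"
proof (rule ccontr)
  assume "x \<noteq> y"
  then have "level_cost u ((x + y) / 2) < level_cost u x"
    using assms by (intro level_cost_strict) (auto simp: level_minimizer_def)
  then show False
    using assms(1) unfolding level_minimizer_def by (metis not_less)
qed

text \<open>The direct method: linear growth of \<open>g\<close> bounds \<open>\<bar>y - y\<^sub>0\<bar>\<close> by the level costs at \<open>y\<close> and \<open>y\<^sub>0\<close>, so a
minimising sequence stays in a compact interval, and Fatou's lemma gives lower semicontinuity.\<close>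
lemma level_minimizer_exists:
  assumes "level_cost u y\<^sub>0 < \<infinity>"
  shows "\<exists>y. level_minimizer u y"
proof -
  define m where "m = (INF y. level_cost u y)"
  have "m \<le> level_cost u y\<^sub>0"
    unfolding m_def by (rule INF_lower) simp
  then have m_fin: "m < \<infinity>"
    using assms by (rule order.strict_trans1)
  obtain C where C: "level_cost u y\<^sub>0 = ennreal C" "0 \<le> C"
    using assms by (cases "level_cost u y\<^sub>0") auto
  obtain a where a: "0 < a" "\<And>t. a * (\<bar>t\<bar> - 1) \<le> g t"
    using linear_growth by metis
  have "\<exists>f. (\<forall>n. f n \<in> range (level_cost u)) \<and> f \<longlonglongrightarrow> m"
    unfolding m_def by (rule Inf_as_limit) simp
  then obtain f where f: "\<forall>n. f n \<in> range (level_cost u)" "f \<longlonglongrightarrow> m"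
    by (elim exE conjE)
  define s where "s n = (SOME y. f n = level_cost u y)" for n
  have "f n = level_cost u (s n)" for n
    unfolding s_def using f(1)[rule_format, of n] by (elim rangeE) (rule someI)
  then have lim: "(\<lambda>n. level_cost u (s n)) \<longlonglongrightarrow> m"
    using f(2) by (metis ext)
  have near: "\<bar>y - y\<^sub>0\<bar> \<le> (enn2real m + 1 + C) / a + 2" if "level_cost u y \<le> m + 1" for y
  proof -
    have "ennreal (a * (\<bar>y - y\<^sub>0\<bar> - 2)) = (\<integral>\<^sup>+\<mu>. ennreal (a * (\<bar>y - y\<^sub>0\<bar> - 2)) \<partial>P)"
      by (simp add: emeasure_space_1)
    also have "\<dots> \<le> (\<integral>\<^sup>+\<mu>. ennreal (g (quantile \<mu> u - y)) + ennreal (g (quantile \<mu> u - y\<^sub>0)) \<partial>P)"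
    proof (rule nn_integral_mono)
      fix \<mu>
      have "\<bar>y - y\<^sub>0\<bar> - 2 \<le> (\<bar>quantile \<mu> u - y\<bar> - 1) + (\<bar>quantile \<mu> u - y\<^sub>0\<bar> - 1)"
        by linarith
      then have "a * (\<bar>y - y\<^sub>0\<bar> - 2) \<le> a * (\<bar>quantile \<mu> u - y\<bar> - 1) + a * (\<bar>quantile \<mu> u - y\<^sub>0\<bar> - 1)"
        unfolding distrib_left[symmetric] using a(1) by (intro mult_left_mono) auto
      also have "\<dots> \<le> g (quantile \<mu> u - y) + g (quantile \<mu> u - y\<^sub>0)"
        by (intro add_mono a)
      finally show "ennreal (a * (\<bar>y - y\<^sub>0\<bar> - 2)) \<le> ennreal (g (quantile \<mu> u - y)) + ennreal (g (quantile \<mu> u - y\<^sub>0))"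
        by (simp add: ennreal_plus[symmetric] ennreal_leI del: ennreal_plus)
    qed
    also have "\<dots> = level_cost u y + level_cost u y\<^sub>0"
      unfolding level_cost_def by (rule nn_integral_add) auto
    also have "\<dots> \<le> (m + 1) + ennreal C"
      using that by (intro add_mono) (simp_all add: C)
    also have "\<dots> = ennreal (enn2real m + 1 + C)"
      using m_fin C(2) by (cases m) (auto simp: ennreal_plus[symmetric] ennreal_1[symmetric] simp del: ennreal_plus ennreal_1)
    finally have "a * (\<bar>y - y\<^sub>0\<bar> - 2) \<le> enn2real m + 1 + C"
      by (subst (asm) ennreal_le_iff) (use C(2) in auto)
    then show ?thesis
      using a(1) by (simp add: field_simps)
  qed
  have "m < m + 1"
    using m_fin ennreal_add_left_cancel_less[of m 0 1] by simp
  then have "\<forall>\<^sub>F n in sequentially. level_cost u (s n) < m + 1"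
    by (rule order_tendstoD(2)[OF lim])
  then obtain N where N: "\<And>n. N \<le> n \<Longrightarrow> level_cost u (s n) < m + 1"
    by (auto simp: eventually_sequentially)
  define K where "K = (enn2real m + 1 + C) / a + 2"
  have "s (n + N) \<in> cball y\<^sub>0 K" for n
    using near[of "s (n + N)"] N[of "n + N"] by (simp add: K_def dist_real_def abs_minus_commute less_imp_le)
  then obtain y r where r: "strict_mono r" "((\<lambda>n. s (n + N)) \<circ> r) \<longlonglongrightarrow> y"
    using compact_cball[of y\<^sub>0 K] unfolding compact_def by (metis (no_types, lifting))
  have "(\<lambda>n. level_cost u (s (r n + N))) \<longlonglongrightarrow> m"
    using LIMSEQ_subseq_LIMSEQ[OF LIMSEQ_ignore_initial_segment[OF lim, of N] r(1)] by (simp add: comp_def)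
  then have "liminf (\<lambda>n. level_cost u (s (r n + N))) = m"
    by (rule lim_imp_Liminf[OF sequentially_bot])
  then have "level_cost u y \<le> m"
    using level_cost_lower_semicontinuous[OF r(2)] by (simp add: comp_def)
  moreover have "m \<le> level_cost u z" for z
    unfolding m_def by (rule INF_lower) simp
  ultimately show ?thesis
    using m_fin unfolding level_minimizer_def by (meson order.trans order.strict_trans1)
qed

end

text \<open>If the minimisers at \<open>u \<le> u'\<close> were in the wrong order, then exchanging them would not increase the
total cost by submodularity, so that the minimiser at \<open>u'\<close> would be a second minimiser at \<open>u\<close>.\<close>
lemma level_minimizer_mono:
  assumes u: "0 < u" "u \<le> u'" "u' < 1"
    and y: "level_minimizer u y" and y': "level_minimizer u' y'"
  shows "y \<le> y'"
proof (rule ccontr)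
  assume "\<not> y \<le> y'"
  then have lt: "y' < y" by simp
  have [measurable]: "(\<lambda>\<mu>. quantile \<mu> u) \<in> borel_measurable P" "(\<lambda>\<mu>. quantile \<mu> u') \<in> borel_measurable P"
    using u by (auto intro: quantile_P)
  have "level_cost u y' + level_cost u' y =
      (\<integral>\<^sup>+\<mu>. ennreal (g (quantile \<mu> u - y')) + ennreal (g (quantile \<mu> u' - y)) \<partial>P)"
    unfolding level_cost_def by (rule nn_integral_add[symmetric]) auto
  also have "\<dots> \<le> (\<integral>\<^sup>+\<mu>. ennreal (g (quantile \<mu> u - y)) + ennreal (g (quantile \<mu> u' - y')) \<partial>P)"
  proof (rule nn_integral_mono)
    fix \<mu> assume "\<mu> \<in> space P"
    then have "quantile \<mu> u \<le> quantile \<mu> u'"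
      using u by (intro quantile_mono) (auto simp: space_P)
    with lt have "g (quantile \<mu> u - y') + g (quantile \<mu> u' - y) \<le> g (quantile \<mu> u - y) + g (quantile \<mu> u' - y')"
      by (intro submodular) auto
    then show "ennreal (g (quantile \<mu> u - y')) + ennreal (g (quantile \<mu> u' - y))
        \<le> ennreal (g (quantile \<mu> u - y)) + ennreal (g (quantile \<mu> u' - y'))"
      by (simp add: ennreal_plus[symmetric] ennreal_leI del: ennreal_plus)
  qed
  also have "\<dots> = level_cost u y + level_cost u' y'"
    unfolding level_cost_def by (rule nn_integral_add) auto
  finally have le: "level_cost u y' + level_cost u' y \<le> level_cost u y + level_cost u' y'" .
  also have "\<dots> < \<infinity>"
    using y y' by (simp add: level_minimizer_def)
  finally have fin: "level_cost u' y < \<infinity>"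
    by simp
  have "level_cost u y' + level_cost u' y \<le> level_cost u y + level_cost u' y"
    using le y' by (meson add_left_mono level_minimizer_def order.trans)
  then have "level_cost u y' \<le> level_cost u y"
    using fin by (metis add.commute ennreal_add_left_cancel_le infinity_ennreal_def less_irrefl)
  then have "level_minimizer u y'"
    using y unfolding level_minimizer_def by (meson order.trans order.strict_trans1)
  then show False
    using level_minimizer_unique[of u y y'] u y lt by simp
qed

text \<open>Levels of finite cost carry a minimiser, and it is measurable because it is monotone in the level.\<close>
lemma measurable_level_minimizer:
  assumes \<nu>0: "real_distribution \<nu>\<^sub>0" and fin: "(\<integral>\<^sup>+\<mu>. transport_cost g \<mu> \<nu>\<^sub>0 \<partial>P) < \<infinity>"
  shows "\<exists>b\<in>borel_measurable unit_lebesgue. AE u in unit_lebesgue. level_minimizer u (b u)"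
proof -
  \<comment> \<open>The reference measure \<open>\<nu>\<^sub>0\<close> provides a measurable set of levels at which the cost is finite somewhere.\<close>
  define S where "S = {u\<in>space unit_lebesgue. level_cost u (quantile \<nu>\<^sub>0 u) < \<infinity>}"
  define b where "b u = (if u \<in> S then THE y. level_minimizer u y else 0)" for u
  have meas [measurable]: "(\<lambda>u. level_cost u (quantile \<nu>\<^sub>0 u)) \<in> borel_measurable unit_lebesgue"
    by (rule level_cost_measurable[OF quantile_measurable[OF \<nu>0]])
  have S: "S \<in> sets unit_lebesgue"
    unfolding S_def by measurable
  have Sb: "S \<in> sets borel" "S \<subseteq> {0<..<1}"
  proof -
    show "S \<subseteq> {0<..<1}" by (auto simp: S_def)
    have "S \<in> sets (restrict_space borel {0<..<1})"
      using S unfolding sets_unit_lebesgue .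
    then show "S \<in> sets borel"
      by (subst (asm) sets_restrict_space_iff) simp_all
  qed
  have b: "level_minimizer u (b u)" if "u \<in> S" for u
  proof -
    have u: "0 < u" "u < 1" and "level_cost u (quantile \<nu>\<^sub>0 u) < \<infinity>"
      using that by (auto simp: S_def)
    then have "\<exists>!y. level_minimizer u y"
      using level_minimizer_exists level_minimizer_unique by metis
    then show ?thesis
      using that theI'[of "level_minimizer u"] by (simp add: b_def)
  qed
  have "mono_on S b"
  proof (rule mono_onI)
    fix r s assume "r \<in> S" "s \<in> S" "r \<le> s"
    then show "b r \<le> b s"
      using Sb by (intro level_minimizer_mono[OF _ \<open>r \<le> s\<close> _ b b]) auto
  qed
  then have "b \<in> borel_measurable (restrict_space borel S)"
    by (rule borel_measurable_mono_on_fnc)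
  then have "(\<lambda>u. if u \<in> S then b u else 0) \<in> borel_measurable borel"
    using Sb by (intro measurable_restrict_space_iff[THEN iffD1]) auto
  also have "(\<lambda>u. if u \<in> S then b u else 0) = b"
    by (auto simp: b_def)
  finally have "b \<in> borel_measurable (restrict_space borel {0<..<1})"
    by (rule measurable_restrict_space1)
  then have "b \<in> borel_measurable unit_lebesgue"
    by (simp only: measurable_cong_sets[OF sets_unit_lebesgue refl])
  moreover have "AE u in unit_lebesgue. level_minimizer u (b u)"
  proof -
    have "AE u in unit_lebesgue. level_cost u (quantile \<nu>\<^sub>0 u) \<noteq> \<infinity>"
      using fin meas unfolding expected_cost_eq[OF \<nu>0]
      by (intro nn_integral_noteq_infinite) auto
    then show ?thesis
      using AE_space
    proof eventually_elim
      fix u assume "level_cost u (quantile \<nu>\<^sub>0 u) \<noteq> \<infinity>" "u \<in> space unit_lebesgue"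
      then show "level_minimizer u (b u)"
        by (intro b) (simp add: S_def less_top)
    qed
  qed
  ultimately show ?thesis by blast
qed

text \<open>The function \<open>b\<close> couples its law with every \<open>\<mu>\<close> through the quantile function of \<open>\<mu>\<close>. This bounds the
cost before \<open>b\<close> is known to be a quantile function.\<close>
lemma expected_cost_le:
  assumes [measurable]: "b \<in> borel_measurable unit_lebesgue"
  shows "(\<integral>\<^sup>+\<mu>. transport_cost g \<mu> (distr unit_lebesgue borel b) \<partial>P)
    \<le> (\<integral>\<^sup>+u. level_cost u (b u) \<partial>unit_lebesgue)"
  unfolding nn_integral_level_cost[OF assms, symmetric]
proof (rule nn_integral_mono)
  fix \<mu> assume "\<mu> \<in> space P"
  then have \<mu>: "real_distribution \<mu>" by (simp add: space_P)
  show "transport_cost g \<mu> (distr unit_lebesgue borel b)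
      \<le> (\<integral>\<^sup>+u. ennreal (g (quantile \<mu> u - b u)) \<partial>unit_lebesgue)"
    using transport_cost_le_unit_lebesgue[of "quantile \<mu>" b g] quantile_measurable[OF \<mu>]
    by (simp add: distr_quantile[OF \<mu>])
qed

text \<open>The level costs of the quantiles of \<open>\<nu>\<close> dominate the optimal ones pointwise and have no larger
integral, which is finite. So they agree almost everywhere, and the level minimiser is unique.\<close>
lemma minimizer_quantile_eq:
  assumes [measurable]: "b \<in> borel_measurable unit_lebesgue"
    and b: "AE u in unit_lebesgue. level_minimizer u (b u)"
    and \<nu>: "real_distribution \<nu>"
    and fin: "(\<integral>\<^sup>+\<mu>. transport_cost g \<mu> \<nu> \<partial>P) < \<infinity>"
    and le: "(\<integral>\<^sup>+\<mu>. transport_cost g \<mu> \<nu> \<partial>P)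
      \<le> (\<integral>\<^sup>+\<mu>. transport_cost g \<mu> (distr unit_lebesgue borel b) \<partial>P)"
  shows "AE u in unit_lebesgue. quantile \<nu> u = b u"
proof -
  have meas: "(\<lambda>u. level_cost u (quantile \<nu> u)) \<in> borel_measurable unit_lebesgue"
    "(\<lambda>u. level_cost u (b u)) \<in> borel_measurable unit_lebesgue"
    by (rule level_cost_measurable[OF quantile_measurable[OF \<nu>]]) (rule level_cost_measurable[OF assms(1)])
  have le': "AE u in unit_lebesgue. level_cost u (b u) \<le> level_cost u (quantile \<nu> u)"
    using b by eventually_elim (simp add: level_minimizer_def)
  have int_le: "(\<integral>\<^sup>+u. level_cost u (quantile \<nu> u) \<partial>unit_lebesgue) \<le> (\<integral>\<^sup>+u. level_cost u (b u) \<partial>unit_lebesgue)"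
    using order.trans[OF le expected_cost_le[OF assms(1)]] unfolding expected_cost_eq[OF \<nu>] .
  have "(\<integral>\<^sup>+u. level_cost u (quantile \<nu> u) \<partial>unit_lebesgue) < \<infinity>"
    using fin unfolding expected_cost_eq[OF \<nu>] .
  with nn_integral_mono_AE[OF le'] have b_fin: "(\<integral>\<^sup>+u. level_cost u (b u) \<partial>unit_lebesgue) < \<infinity>"
    by (rule order.strict_trans1)
  have "(\<integral>\<^sup>+u. level_cost u (quantile \<nu> u) - level_cost u (b u) \<partial>unit_lebesgue) =
      (\<integral>\<^sup>+u. level_cost u (quantile \<nu> u) \<partial>unit_lebesgue) - (\<integral>\<^sup>+u. level_cost u (b u) \<partial>unit_lebesgue)"
    using b_fin le' meas by (intro nn_integral_diff) auto
  also have "\<dots> = 0"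
    using int_le b_fin by (intro diff_eq_0_ennreal) auto
  finally have "(\<integral>\<^sup>+u. level_cost u (quantile \<nu> u) - level_cost u (b u) \<partial>unit_lebesgue) = 0" .
  then have "AE u in unit_lebesgue. level_cost u (quantile \<nu> u) - level_cost u (b u) = 0"
    using meas by (subst (asm) nn_integral_0_iff_AE) auto
  then show ?thesis
    using b AE_space
  proof eventually_elim
    fix u assume eq: "level_cost u (quantile \<nu> u) - level_cost u (b u) = 0"
      and bu: "level_minimizer u (b u)" and u: "u \<in> space unit_lebesgue"
    then have "level_cost u (quantile \<nu> u) \<le> level_cost u (b u)"
      by (metis diff_gt_0_iff_gt_ennreal less_irrefl not_le infinity_ennreal_def level_minimizer_def)
    then have "level_minimizer u (quantile \<nu> u)"
      using bu unfolding level_minimizer_def by (meson order.trans order.strict_trans1)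
    then show "quantile \<nu> u = b u"
      using level_minimizer_unique[of u "quantile \<nu> u" "b u"] bu u by simp
  qed
qed

text \<open>The law of a measurable selection \<open>b\<close> of level minimisers attains the lower bound given by the level
costs. Every other minimiser has the quantile function \<open>b\<close> almost everywhere and is therefore the same
measure; in particular the quantile function of the barycenter is itself a selection of level
minimisers.\<close>
theorem law_barycenter_level_minimizer:
  assumes \<nu>0: "real_distribution \<nu>\<^sub>0" and fin: "(\<integral>\<^sup>+\<mu>. transport_cost g \<mu> \<nu>\<^sub>0 \<partial>P) < \<infinity>"
  shows "real_distribution (law_barycenter g P) \<and>
    (AE u in unit_lebesgue. level_minimizer u (quantile (law_barycenter g P) u))"
proof -
  obtain b where [measurable]: "b \<in> borel_measurable unit_lebesgue"
    and b: "AE u in unit_lebesgue. level_minimizer u (b u)"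
    using measurable_level_minimizer[OF assms] by blast
  let ?cost = "\<lambda>\<nu>. \<integral>\<^sup>+\<mu>. transport_cost g \<mu> \<nu> \<partial>P"
  let ?\<beta> = "distr unit_lebesgue borel b"
  have \<beta>: "real_distribution ?\<beta>"
    by (rule real_distribution_distr_unit_lebesgue) simp
  have \<beta>_le: "?cost ?\<beta> \<le> ?cost \<nu>" if "real_distribution \<nu>" for \<nu>
  proof -
    have "AE u in unit_lebesgue. level_cost u (b u) \<le> level_cost u (quantile \<nu> u)"
      using b by eventually_elim (simp add: level_minimizer_def)
    then have "(\<integral>\<^sup>+u. level_cost u (b u) \<partial>unit_lebesgue) \<le> ?cost \<nu>"
      unfolding expected_cost_eq[OF that] by (rule nn_integral_mono_AE)
    with expected_cost_le show ?thesis
      by (rule order.trans) measurable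
  qed
  have min: "is_arg_min ?cost real_distribution ?\<beta>"
    unfolding is_arg_min_linorder using \<beta> \<beta>_le by blast
  have quantile: "AE u in unit_lebesgue. quantile \<nu> u = b u"
    if "is_arg_min ?cost real_distribution \<nu>" for \<nu>
  proof (rule minimizer_quantile_eq[OF _ b])
    show "?cost \<nu> < \<infinity>"
      using that \<nu>0 fin unfolding is_arg_min_linorder by (meson order.strict_trans1)
  qed (use that \<beta> in \<open>auto simp: is_arg_min_linorder\<close>)
  have uniq: "\<nu> = ?\<beta>" if "is_arg_min ?cost real_distribution \<nu>" for \<nu>
  proof -
    have \<nu>: "real_distribution \<nu>" using that by (simp add: is_arg_min_def)
    have "\<nu> = distr unit_lebesgue borel (quantile \<nu>)"
      by (rule distr_quantile[OF \<nu>, symmetric])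
    also have "\<dots> = ?\<beta>"
      using quantile[OF that] quantile_measurable[OF \<nu>] by (intro distr_cong_AE) auto
    finally show ?thesis .
  qed
  have "law_barycenter g P = ?\<beta>"
    unfolding law_barycenter_def using min uniq by (rule the_equality)
  moreover have "AE u in unit_lebesgue. level_minimizer u (quantile ?\<beta> u)"
    using quantile[OF min] b by eventually_elim simp
  ultimately show ?thesis
    using \<beta> by simp
qed

end

section \<open>Weak convergence from quantiles\<close>

lemma AE_unit_lebesgue_witness:
  assumes AE: "AE v in unit_lebesgue. Q v" and ab: "0 \<le> a" "a < b" "b \<le> 1"
  shows "\<exists>v. a < v \<and> v < b \<and> Q v"
proof (rule ccontr)
  assume "\<nexists>v. a < v \<and> v < b \<and> Q v"
  then have none: "\<not> Q v" if "a < v" "v < b" for v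
    using that by blast
  have "AE v in lborel. v \<notin> {a<..<b}"
    using AE[unfolded AE_unit_lebesgue_iff]
  proof eventually_elim
    case (elim v)
    then show ?case using none[of v] ab by auto
  qed
  then have "emeasure lborel {a<..<b} = 0"
    by (subst (asm) AE_iff_measurable[of "{a<..<b}"]) auto
  then show False using ab by simp
qed

lemma countable_dense_of_AE:
  assumes "AE v in unit_lebesgue. Q v"
  shows "\<exists>D. countable D \<and> (\<forall>v\<in>D. Q v) \<and> (\<forall>a b. 0 \<le> a \<longrightarrow> a < b \<longrightarrow> b \<le> 1 \<longrightarrow> (\<exists>v\<in>D. a < v \<and> v < b))"
proof -
  define pick where "pick p = (SOME v. fst p < v \<and> v < snd p \<and> Q v)" for p :: "real \<times> real"
  define I :: "(real \<times> real) set" where "I = {p\<in>\<rat> \<times> \<rat>. 0 \<le> fst p \<and> fst p < snd p \<and> snd p \<le> 1}"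
  have pick: "fst p < pick p \<and> pick p < snd p \<and> Q (pick p)" if "p \<in> I" for p
  proof -
    have "\<exists>v. fst p < v \<and> v < snd p \<and> Q v"
      using that by (intro AE_unit_lebesgue_witness[OF assms]) (simp_all add: I_def)
    then show ?thesis unfolding pick_def by (rule someI_ex)
  qed
  have "countable (pick ` I)"
  proof (rule countable_image, rule countable_subset)
    show "I \<subseteq> \<rat> \<times> \<rat>" by (auto simp: I_def)
    show "countable (\<rat> \<times> \<rat> :: (real \<times> real) set)" by (intro countable_SIGMA countable_rat)
  qed
  moreover have "\<exists>v\<in>pick ` I. a < v \<and> v < b" if "0 \<le> a" "a < b" "b \<le> 1" for a b
  proof -
    obtain p where p: "p \<in> \<rat>" "a < p" "p < b"
      using Rats_dense_in_real[OF \<open>a < b\<close>] by blast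
    obtain q where q: "q \<in> \<rat>" "p < q" "q < b"
      using Rats_dense_in_real[OF \<open>p < b\<close>] by blast
    have "(p, q) \<in> I"
      using p q that by (simp add: I_def)
    with pick[OF this] p q show ?thesis
      by (intro bexI[of _ "pick (p, q)"]) auto
  qed
  ultimately show ?thesis
    using pick by (intro exI[of _ "pick ` I"]) auto
qed

text \<open>Convergence of quantiles on a dense set of levels squeezes the distribution functions at continuity
points of the limit. The bounds are required only for almost every level \<open>v\<close> on either side of \<open>u\<close>,
because the quantiles of a barycenter are identified only up to null sets of levels.\<close>
lemma weak_conv_m_of_quantiles:
  assumes \<nu>s: "\<And>n. real_distribution (\<nu>s n)" and \<nu>: "real_distribution \<nu>"
    and dense: "\<And>a b. 0 \<le> a \<Longrightarrow> a < b \<Longrightarrow> b \<le> 1 \<Longrightarrow> \<exists>u\<in>D. a < u \<and> u < b"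
    and conv: "\<And>u e. u \<in> D \<Longrightarrow> 0 < e \<Longrightarrow> \<forall>\<^sub>F n in sequentially. AE v in unit_lebesgue.
      (v \<le> u \<longrightarrow> quantile (\<nu>s n) v \<le> quantile \<nu> u + e) \<and> (u \<le> v \<longrightarrow> quantile \<nu> u - e \<le> quantile (\<nu>s n) v)"
  shows "weak_conv_m \<nu>s \<nu>"
  unfolding weak_conv_m_def weak_conv_def
proof (intro allI impI)
  fix x assume cont: "isCont (cdf \<nu>) x"
  interpret \<nu>: real_distribution \<nu> by fact
  interpret \<nu>s: real_distribution "\<nu>s n" for n by fact
  show "(\<lambda>n. cdf (\<nu>s n) x) \<longlonglongrightarrow> cdf \<nu> x"
  proof (rule order_tendstoI)
    fix r assume r: "r < cdf \<nu> x"
    show "\<forall>\<^sub>F n in sequentially. r < cdf (\<nu>s n) x"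
    proof (cases "r < 0")
      case True
      then show ?thesis
        by (intro always_eventually allI) (rule less_le_trans[OF _ \<nu>s.cdf_nonneg])
    next
      case False
      have "((cdf \<nu>) \<longlongrightarrow> cdf \<nu> x) (at_left x)"
        using cont unfolding isCont_def by (rule filterlim_mono[OF _ order_refl at_le]) simp
      from eventually_conj[OF order_tendstoD(1)[OF this r] eventually_at_left_real[of "x - 1" x]]
      obtain z where z: "r < cdf \<nu> z" "z < x"
        by (auto dest!: eventually_happens)
      obtain u where u: "u \<in> D" "r < u" "u < cdf \<nu> z"
        using dense[of r "cdf \<nu> z"] z False \<nu>.cdf_bounded_prob[of z] by auto
      have u01: "0 < u" "u < 1"
        using u False \<nu>.cdf_bounded_prob[of z] by auto
      have "quantile \<nu> u \<le> z"
        using quantile_le_iff[OF \<nu> u01] u by simp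
      then have q: "quantile \<nu> u + (x - z) \<le> x" by simp
      have "0 < x - z" using z by simp
      show ?thesis
        using conv[OF u(1) \<open>0 < x - z\<close>]
      proof eventually_elim
        case (elim n)
        then have "AE v in unit_lebesgue. v \<le> u \<longrightarrow> v \<le> cdf (\<nu>s n) x"
          using AE_space
        proof eventually_elim
          case (elim v)
          then show ?case
            using q quantile_le_iff[OF \<nu>s, of v n x] by auto
        qed
        then have "u \<le> cdf (\<nu>s n) x"
          using AE_unit_lebesgue_witness[of "\<lambda>v. v \<le> u \<longrightarrow> v \<le> cdf (\<nu>s n) x" "cdf (\<nu>s n) x" u] u01
            \<nu>s.cdf_nonneg[of n x] by force
        then show ?case using u by simp
      qed
    qed
  next
    fix r assume r: "cdf \<nu> x < r"
    show "\<forall>\<^sub>F n in sequentially. cdf (\<nu>s n) x < r"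
    proof (cases "1 < r")
      case True
      then show ?thesis
        by (intro always_eventually allI) (rule le_less_trans[OF \<nu>s.cdf_bounded_prob])
    next
      case False
      obtain u where u: "u \<in> D" "cdf \<nu> x < u" "u < r"
        using dense[of "cdf \<nu> x" r] r False \<nu>.cdf_nonneg[of x] by auto
      have u01: "0 < u" "u < 1"
        using u False \<nu>.cdf_nonneg[of x] by auto
      have q: "x < quantile \<nu> u"
        using quantile_le_iff[OF \<nu> u01, of x] u by simp
      define e where "e = (quantile \<nu> u - x) / 2"
      have e: "0 < e" "x < quantile \<nu> u - e"
        using q by (auto simp: e_def field_simps)
      show ?thesis
        using conv[OF u(1) e(1)]
      proof eventually_elim
        case (elim n)
        then have "AE v in unit_lebesgue. u \<le> v \<longrightarrow> cdf (\<nu>s n) x < v"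
          using AE_space
        proof eventually_elim
          case (elim v)
          then show ?case
            using e quantile_le_iff[OF \<nu>s, of v n x] by auto
        qed
        then have "cdf (\<nu>s n) x \<le> u"
          using AE_unit_lebesgue_witness[of "\<lambda>v. u \<le> v \<longrightarrow> cdf (\<nu>s n) x < v" u "cdf (\<nu>s n) x"] u01
            \<nu>s.cdf_bounded_prob[of n x] by force
        then show ?case using u by simp
      qed
    qed
  qed
qed

text \<open>If the cost at \<open>y\<close> is below the costs at \<open>y - e\<close> and \<open>y + e\<close>, then quasiconvexity leaves no room for a
minimiser outside the interval between them.\<close>
lemma (in random_measure_law) level_minimizer_between:
  assumes u: "0 < u" "u < 1" and z: "level_minimizer u z"
    and less: "level_cost u y < level_cost u (y - e)" "level_cost u y < level_cost u (y + e)" and "0 < e"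
  shows "y - e < z" "z < y + e"
proof -
  have le: "level_cost u z \<le> level_cost u y"
    using z by (simp add: level_minimizer_def)
  show "y - e < z"
  proof (rule ccontr)
    assume "\<not> y - e < z"
    then have "level_cost u (y - e) \<le> max (level_cost u z) (level_cost u y)"
      using \<open>0 < e\<close> by (intro level_cost_quasiconvex[OF u]) auto
    with le less show False by (simp add: max_def split: if_splits)
  qed
  show "z < y + e"
  proof (rule ccontr)
    assume "\<not> z < y + e"
    then have "level_cost u (y + e) \<le> max (level_cost u y) (level_cost u z)"
      using \<open>0 < e\<close> by (intro level_cost_quasiconvex[OF u]) auto
    with le less show False by (simp add: max_def split: if_splits)
  qed
qed

section \<open>Barycenters of empirical laws\<close>
definition empirical_law :: "nat \<Rightarrow> (nat \<Rightarrow> real measure) \<Rightarrow> real measure measure" where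
  "empirical_law n \<mu> = distr (uniform_count_measure {1..n}) weak_borel \<mu>"

lemma empirical_law_rv:
  assumes "\<And>i. 1 \<le> i \<Longrightarrow> real_distribution (\<mu> i)"
  shows "\<mu> \<in> uniform_count_measure {1..n} \<rightarrow>\<^sub>M weak_borel"
  using assms by (auto simp: measurable_def space_weak_borel space_uniform_count_measure sets_uniform_count_measure)

lemma nn_integral_empirical_law:
  assumes "\<And>i. 1 \<le> i \<Longrightarrow> real_distribution (\<mu> i)" and "f \<in> borel_measurable weak_borel"
  shows "(\<integral>\<^sup>+m. f m \<partial>empirical_law n \<mu>) = (\<Sum>i=1..n. ennreal (1 / real n) * f (\<mu> i))"
proof -
  have "(\<integral>\<^sup>+m. f m \<partial>empirical_law n \<mu>) = (\<integral>\<^sup>+i. f (\<mu> i) \<partial>uniform_count_measure {1..n})"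
    unfolding empirical_law_def
    by (rule nn_integral_distr[OF empirical_law_rv]) (use assms in simp_all)
  then show ?thesis
    unfolding uniform_count_measure_def by (simp add: nn_integral_point_measure_finite)
qed

context strict_transport_profile
begin

lemma random_measure_law_empirical:
  assumes "\<And>i. 1 \<le> i \<Longrightarrow> real_distribution (\<mu> i)" and "1 \<le> n"
  shows "random_measure_law g (empirical_law n \<mu>)"
proof -
  interpret U: prob_space "uniform_count_measure {1..n}"
    by (rule prob_space_uniform_count_measure) (use assms in auto)
  have "prob_space (empirical_law n \<mu>)"
    unfolding empirical_law_def by (rule U.prob_space_distr[OF empirical_law_rv[OF assms(1)]])
  then show ?thesis
    by (simp add: random_measure_law_def random_measure_law_axioms_def strict_transport_profile_axioms empirical_law_def)
qed

text \<open>The two functionals agree at every probability measure, so their minimisers are the same and the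
results on barycenters of laws cover the empirical barycenters.\<close>
lemma frechet_barycenter_eq_law_barycenter:
  assumes "\<And>i. 1 \<le> i \<Longrightarrow> real_distribution (\<mu> i)"
  shows "frechet_barycenter g n \<mu> (\<lambda>_. 1 / real n) = law_barycenter g (empirical_law n \<mu>)"
proof -
  have "(\<Sum>i=1..n. ennreal (1 / real n) * transport_cost g (\<mu> i) \<nu>) = (\<integral>\<^sup>+m. transport_cost g m \<nu> \<partial>empirical_law n \<mu>)"
    if "real_distribution \<nu>" for \<nu>
    by (rule nn_integral_empirical_law[OF assms transport_cost_measurable[OF that], symmetric])
  then have "is_arg_min (\<lambda>\<nu>. \<Sum>i=1..n. ennreal (1 / real n) * transport_cost g (\<mu> i) \<nu>) real_distribution =
      is_arg_min (\<lambda>\<nu>. \<integral>\<^sup>+m. transport_cost g m \<nu> \<partial>empirical_law n \<mu>) real_distribution"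
    by (intro ext) (simp add: is_arg_min_linorder cong: conj_cong imp_cong)
  then show ?thesis
    unfolding frechet_barycenter_def law_barycenter_def by (simp only:)
qed

end

section \<open>Almost sure convergence of the empirical barycenters\<close>
locale iid_random_measures = random_measure_law g P + M: prob_space M
  for g :: "real \<Rightarrow> real" and P :: "real measure measure" and M :: "'w measure" +
  fixes X :: "nat \<Rightarrow> 'w \<Rightarrow> real measure"
  assumes indep_X: "M.indep_vars (\<lambda>_. weak_borel) X {1..}"
    and distr_X: "\<And>n. 1 \<le> n \<Longrightarrow> distr M weak_borel (X n) = P"
begin

lemma rv_X: "1 \<le> i \<Longrightarrow> X i \<in> M \<rightarrow>\<^sub>M weak_borel"
  using indep_X by (simp add: M.indep_vars_def)

lemma real_distribution_X: "1 \<le> i \<Longrightarrow> \<omega> \<in> space M \<Longrightarrow> real_distribution (X i \<omega>)"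
  using measurable_space[OF rv_X] by (auto simp: space_weak_borel)

lemma random_measure_law_empirical_X:
  "\<omega> \<in> space M \<Longrightarrow> 1 \<le> n \<Longrightarrow> random_measure_law g (empirical_law n (\<lambda>i. X i \<omega>))"
  by (rule random_measure_law_empirical) (auto intro: real_distribution_X)

lemma iid_quantiles:
  assumes u: "0 < u" "u < 1"
  shows "iid_sequence M (\<lambda>i \<omega>. quantile (X (Suc i) \<omega>) u)"
proof
  note q = quantile_measurable_weak_borel[OF u]
  have "M.indep_vars (\<lambda>_. weak_borel) (\<lambda>i. X (Suc i)) UNIV"
    by (rule M.indep_vars_reindex[where f = Suc]) (auto intro: M.indep_vars_subset[OF indep_X])
  then show "M.indep_vars (\<lambda>_. borel) (\<lambda>i \<omega>. quantile (X (Suc i) \<omega>) u) UNIV"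
    by (rule M.indep_vars_compose2) (rule q)
  have "distr M borel (\<lambda>\<omega>. quantile (X (Suc i) \<omega>) u) = distr P borel (\<lambda>\<mu>. quantile \<mu> u)" for i
    using distr_distr[OF q rv_X[of "Suc i"]] by (simp add: distr_X comp_def)
  then show "distr M borel (\<lambda>\<omega>. quantile (X (Suc i) \<omega>) u) = distr M borel (\<lambda>\<omega>. quantile (X (Suc 0) \<omega>) u)" for i
    by simp
qed

lemma empirical_level_cost:
  assumes u: "0 < u" "u < 1" and \<omega>: "\<omega> \<in> space M" and n: "1 \<le> n"
  shows "random_measure_law.level_cost g (empirical_law n (\<lambda>i. X i \<omega>)) u y =
    ennreal (1 / real n * (\<Sum>i<n. g (quantile (X (Suc i) \<omega>) u - y)))"
proof -
  interpret E: random_measure_law g "empirical_law n (\<lambda>i. X i \<omega>)"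
    by (rule random_measure_law_empirical_X[OF \<omega> n])
  note [measurable] = quantile_measurable_weak_borel[OF u]
  have "E.level_cost u y = (\<Sum>i=1..n. ennreal (1 / real n) * ennreal (g (quantile (X i \<omega>) u - y)))"
    unfolding E.level_cost_def by (rule nn_integral_empirical_law) (auto intro: real_distribution_X \<omega>)
  also have "\<dots> = (\<Sum>i<n. ennreal (1 / real n) * ennreal (g (quantile (X (Suc i) \<omega>) u - y)))"
    by (rule sum.reindex_bij_witness[of _ Suc "\<lambda>i. i - 1"]) auto
  also have "\<dots> = ennreal (1 / real n * (\<Sum>i<n. g (quantile (X (Suc i) \<omega>) u - y)))"
    by (simp add: ennreal_mult[symmetric] sum_divide_distrib)
  finally show ?thesis .
qed

text \<open>At a fixed level the quantiles of the random measures are i.i.d. real random variables, and the level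
costs of the empirical law are their averaged costs.\<close>
lemma AE_empirical_level_cost_less:
  assumes u: "0 < u" "u < 1" and less: "level_cost u y < level_cost u z"
  shows "AE \<omega> in M. \<forall>\<^sub>F n in sequentially.
    random_measure_law.level_cost g (empirical_law n (\<lambda>i. X i \<omega>)) u y <
    random_measure_law.level_cost g (empirical_law n (\<lambda>i. X i \<omega>)) u z"
proof -
  interpret Q: iid_sequence M "\<lambda>i \<omega>. quantile (X (Suc i) \<omega>) u"
    by (rule iid_quantiles[OF u])
  note [measurable] = quantile_measurable_weak_borel[OF u]
  have cost: "(\<integral>\<^sup>+\<omega>. ennreal (g (quantile (X (Suc 0) \<omega>) u - y)) \<partial>M) = level_cost u y" for y
  proof -
    have "(\<integral>\<^sup>+\<omega>. ennreal (g (quantile (X (Suc 0) \<omega>) u - y)) \<partial>M) =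
        (\<integral>\<^sup>+\<mu>. ennreal (g (quantile \<mu> u - y)) \<partial>distr M weak_borel (X (Suc 0)))"
      by (rule nn_integral_distr[symmetric, OF rv_X]) simp_all
    then show ?thesis
      by (simp add: level_cost_def distr_X)
  qed
  have "AE \<omega> in M. \<forall>\<^sub>F n in sequentially.
      (\<Sum>i<n. g (quantile (X (Suc i) \<omega>) u - y)) < (\<Sum>i<n. g (quantile (X (Suc i) \<omega>) u - z))"
    by (rule Q.sums_eventually_less) (use less in \<open>simp_all add: cost\<close>)
  then show ?thesis
    using AE_space
  proof eventually_elim
    case (elim \<omega>)
    from elim(1) eventually_ge_at_top[of 1] show ?case
    proof eventually_elim
      case (elim n)
      then show ?case
        using \<open>\<omega> \<in> space M\<close>
        by (simp add: empirical_level_cost[OF u] ennreal_less_iff sum_nonneg divide_strict_right_mono)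
    qed
  qed
qed

lemma AE_transport_cost_finite:
  assumes \<nu>: "real_distribution \<nu>" and fin: "(\<integral>\<^sup>+\<mu>. transport_cost g \<mu> \<nu> \<partial>P) < \<infinity>"
  shows "AE \<omega> in M. \<forall>i\<ge>1. transport_cost g (X i \<omega>) \<nu> < \<infinity>"
proof -
  have "AE \<omega> in M. 1 \<le> i \<longrightarrow> transport_cost g (X i \<omega>) \<nu> < \<infinity>" for i
  proof (cases "1 \<le> i")
    case True
    have "(\<integral>\<^sup>+\<omega>. transport_cost g (X i \<omega>) \<nu> \<partial>M) = (\<integral>\<^sup>+\<mu>. transport_cost g \<mu> \<nu> \<partial>distr M weak_borel (X i))"
      by (rule nn_integral_distr[symmetric, OF rv_X[OF True]]) (simp add: transport_cost_measurable[OF \<nu>])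
    then have "(\<integral>\<^sup>+\<omega>. transport_cost g (X i \<omega>) \<nu> \<partial>M) \<noteq> \<infinity>"
      using fin by (simp add: distr_X[OF True])
    then have "AE \<omega> in M. transport_cost g (X i \<omega>) \<nu> \<noteq> \<infinity>"
      using measurable_compose[OF rv_X[OF True] transport_cost_measurable[OF \<nu>]]
      by (intro nn_integral_noteq_infinite)
    then show ?thesis
      by eventually_elim (simp add: less_top)
  qed simp
  then have "AE \<omega> in M. \<forall>i. 1 \<le> i \<longrightarrow> transport_cost g (X i \<omega>) \<nu> < \<infinity>"
    by (subst AE_all_countable) blast
  then show ?thesis by simp
qed

text \<open>A countable dense set \<open>D\<close> of levels and countably many displacements suffice, so one null set serves
all of them. Outside of it, for \<open>u\<close> in \<open>D\<close>, the empirical level cost at the \<open>u\<close>-quantile of the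
barycenter is eventually below its values at distance \<open>d\<close> to both sides, which traps the empirical
minimiser \<open>z\<close> at level \<open>u\<close>. Monotonicity in the level compares \<open>z\<close> with the quantiles of the empirical
barycenter at almost every other level.\<close>
theorem empirical_barycenters_converge:
  assumes \<nu>0: "real_distribution \<nu>\<^sub>0" and fin: "(\<integral>\<^sup>+\<mu>. transport_cost g \<mu> \<nu>\<^sub>0 \<partial>P) < \<infinity>"
  shows "AE \<omega> in M. limitin weak_topology
    (\<lambda>n. frechet_barycenter g n (\<lambda>i. X i \<omega>) (\<lambda>_. 1 / real n)) (law_barycenter g P) sequentially"
proof -
  let ?q = "quantile (law_barycenter g P)"
  let ?E = "\<lambda>n \<omega>. empirical_law n (\<lambda>i. X i \<omega>)"
  have bary: "real_distribution (law_barycenter g P)"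
    and min: "AE u in unit_lebesgue. level_minimizer u (?q u)"
    using law_barycenter_level_minimizer[OF \<nu>0 fin] by auto
  have "AE u in unit_lebesgue. 0 < u \<and> u < 1 \<and> level_minimizer u (?q u)"
    using min AE_space by eventually_elim simp
  then obtain D where "countable D" and D: "\<And>u. u \<in> D \<Longrightarrow> 0 < u \<and> u < 1 \<and> level_minimizer u (?q u)"
    and dense: "\<And>a b. 0 \<le> a \<Longrightarrow> a < b \<Longrightarrow> b \<le> 1 \<Longrightarrow> \<exists>v\<in>D. a < v \<and> v < b"
    using countable_dense_of_AE by (metis (no_types, lifting))
  define near where "near \<omega> u e \<longleftrightarrow> (\<forall>\<^sub>F n in sequentially.
      random_measure_law.level_cost g (?E n \<omega>) u (?q u) < random_measure_law.level_cost g (?E n \<omega>) u (?q u + e))"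
    for \<omega> u e
  have near: "AE \<omega> in M. near \<omega> u e" if "u \<in> D" "e \<noteq> 0" for u e
    unfolding near_def
  proof (rule AE_empirical_level_cost_less)
    have u: "0 < u" "u < 1" "level_minimizer u (?q u)" using D \<open>u \<in> D\<close> by auto
    then have "level_cost u (?q u) \<noteq> level_cost u (?q u + e)"
      using level_minimizer_unique[OF u(1,2), of "?q u" "?q u + e"] \<open>e \<noteq> 0\<close>
      unfolding level_minimizer_def by auto
    then show "level_cost u (?q u) < level_cost u (?q u + e)"
      using u(3) by (simp add: level_minimizer_def order.not_eq_order_implies_strict)
  qed (use D that in auto)
  have "AE \<omega> in M. near \<omega> u (1 / real (Suc k)) \<and> near \<omega> u (- (1 / real (Suc k)))" if "u \<in> D" for u k
  proof -
    have "1 / real (Suc k) \<noteq> 0" "- (1 / real (Suc k)) \<noteq> 0" by simp_all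
    from near[OF that this(1)] near[OF that this(2)] show ?thesis
      by eventually_elim (rule conjI)
  qed
  then have "AE \<omega> in M. \<forall>u\<in>D. \<forall>k. near \<omega> u (1 / real (Suc k)) \<and> near \<omega> u (- (1 / real (Suc k)))"
    unfolding AE_ball_countable[OF \<open>countable D\<close>] AE_all_countable by blast
  then show ?thesis
    using AE_transport_cost_finite[OF \<nu>0 fin] AE_space
  proof eventually_elim
    fix \<omega> assume near_\<omega>: "\<forall>u\<in>D. \<forall>k. near \<omega> u (1 / real (Suc k)) \<and> near \<omega> u (- (1 / real (Suc k)))"
      and fin_\<omega>: "\<forall>i\<ge>1. transport_cost g (X i \<omega>) \<nu>\<^sub>0 < \<infinity>" and \<omega>: "\<omega> \<in> space M"
    let ?\<nu> = "\<lambda>n. law_barycenter g (?E n \<omega>)"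
    have law: "random_measure_law g (?E n \<omega>)" if "1 \<le> n" for n
      by (rule random_measure_law_empirical_X[OF \<omega> that])
    have emp: "real_distribution (?\<nu> n) \<and>
        (AE v in unit_lebesgue. random_measure_law.level_minimizer g (?E n \<omega>) v (quantile (?\<nu> n) v))"
      if "1 \<le> n" for n
    proof (rule random_measure_law.law_barycenter_level_minimizer[OF law[OF that] \<nu>0])
      have "(\<integral>\<^sup>+\<mu>. transport_cost g \<mu> \<nu>\<^sub>0 \<partial>?E n \<omega>) = (\<Sum>i=1..n. ennreal (1 / real n) * transport_cost g (X i \<omega>) \<nu>\<^sub>0)"
        by (rule nn_integral_empirical_law[OF _ transport_cost_measurable[OF \<nu>0]])
           (rule real_distribution_X[OF _ \<omega>])
      also have "\<dots> < \<infinity>"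
        using fin_\<omega> by (auto simp: ennreal_mult_less_top)
      finally show "(\<integral>\<^sup>+\<mu>. transport_cost g \<mu> \<nu>\<^sub>0 \<partial>?E n \<omega>) < \<infinity>" .
    qed
    \<comment> \<open>The empirical law is a probability measure only from \<open>n = 1\<close> on, hence the shift of the index.\<close>
    have "weak_conv_m (\<lambda>n. ?\<nu> (Suc n)) (law_barycenter g P)"
    proof (rule weak_conv_m_of_quantiles[OF _ bary dense])
      fix u e :: real assume u: "u \<in> D" and "0 < e"
      then have u01: "0 < u" "u < 1" using D by auto
      obtain k where "inverse (real (Suc k)) < e"
        using reals_Archimedean[OF \<open>0 < e\<close>] by blast
      define d where "d = 1 / real (Suc k)"
      have d: "0 < d" "d < e"
        using \<open>inverse (real (Suc k)) < e\<close> by (simp_all add: d_def inverse_eq_divide del: of_nat_Suc)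
      have "near \<omega> u d" "near \<omega> u (- d)"
        using near_\<omega> u by (simp_all add: d_def del: of_nat_Suc)
      then have "\<forall>\<^sub>F n in sequentially. AE v in unit_lebesgue.
          (v \<le> u \<longrightarrow> quantile (?\<nu> n) v \<le> ?q u + e) \<and> (u \<le> v \<longrightarrow> ?q u - e \<le> quantile (?\<nu> n) v)"
        unfolding near_def using eventually_ge_at_top[of 1]
      proof eventually_elim
        case (elim n)
        interpret E: random_measure_law g "?E n \<omega>" by (rule law[OF elim(3)])
        have "E.level_cost u (?q u) < \<infinity>"
          unfolding empirical_level_cost[OF u01 \<omega> elim(3)] by simp
        then obtain z where z: "E.level_minimizer u z"
          using E.level_minimizer_exists[OF u01] by blast
        have zd: "?q u - d < z" "z < ?q u + d"
          using E.level_minimizer_between[OF u01 z, of "?q u" d] elim d by simp_all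
        from emp[OF elim(3)] have "AE v in unit_lebesgue. E.level_minimizer v (quantile (?\<nu> n) v)"
          by simp
        then show ?case
          using AE_space
        proof eventually_elim
          case (elim v)
          then have v: "0 < v" "v < 1" by simp_all
          show ?case
            using E.level_minimizer_mono[of v u, OF v(1) _ u01(2) elim(1) z]
              E.level_minimizer_mono[of u v, OF u01(1) _ v(2) z elim(1)] zd d by fastforce
        qed
      qed
      then show "\<forall>\<^sub>F n in sequentially. AE v in unit_lebesgue.
          (v \<le> u \<longrightarrow> quantile (?\<nu> (Suc n)) v \<le> ?q u + e) \<and> (u \<le> v \<longrightarrow> ?q u - e \<le> quantile (?\<nu> (Suc n)) v)"
        by (subst eventually_sequentially_Suc)
    qed (use emp in simp)
    then have "limitin weak_topology (\<lambda>n. ?\<nu> (n + 1)) (law_barycenter g P) sequentially"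
      using limitin_weak_topology_iff_weak_conv_m[of "\<lambda>n. ?\<nu> (Suc n)" "law_barycenter g P"] bary emp by simp
    then have "limitin weak_topology ?\<nu> (law_barycenter g P) sequentially"
      by (rule limitin_sequentially_offset_rev)
    then show "limitin weak_topology
        (\<lambda>n. frechet_barycenter g n (\<lambda>i. X i \<omega>) (\<lambda>_. 1 / real n)) (law_barycenter g P) sequentially"
      by (simp add: frechet_barycenter_eq_law_barycenter real_distribution_X \<omega>)
  qed
qed

end

theorem theorem5:
  fixes g :: "real \<Rightarrow> real"
    and P :: "real measure measure"
    and M :: "'w measure"
    and X :: "nat \<Rightarrow> 'w \<Rightarrow> real measure"
  assumes "strictly_convex g" and "\<And>x. g 0 \<le> g x" and "g 0 = 0"
    and "prob_space P" and "sets P = sets weak_borel"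
    and "prob_space M"
    and "prob_space.indep_vars M (\<lambda>_. weak_borel) X {1..}"
    and "\<And>n. n \<ge> 1 \<Longrightarrow> distr M weak_borel (X n) = P"
    and "\<exists>\<nu>. real_distribution \<nu> \<and> (\<integral>\<^sup>+ \<mu>. transport_cost g \<mu> \<nu> \<partial>P) < \<infinity>"
  shows "AE \<omega> in M. limitin weak_topology
           (\<lambda>n. frechet_barycenter g n (\<lambda>i. X i \<omega>) (\<lambda>_. 1 / real n))
           (law_barycenter g P) sequentially"
proof -
  interpret iid_random_measures g P M X
    using assms(1-8)
    by (simp add: iid_random_measures_def iid_random_measures_axioms_def random_measure_law_def
        random_measure_law_axioms_def strict_transport_profile_def)
  show ?thesis
    using assms(9) empirical_barycenters_converge by blast
qed

end
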